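(* Let $(\mathcal A,\mathcal A_0)$ be a metatangible mon-pair. (i) Define $\mu(a)=a^\circ$ for $a\in\mathcal T_0$. Then $\mu:\mathcal T_0\to\mathcal T_0^\odot$ is a monoid homomorphism. (ii) Suppose $(\mathcal A,\mathcal A_0)$ is $\mathcal A_0$-bipotent. (a) $\mathcal T_0^\odot$ becomes an idempotent semiring under the multiplication $\odot$ and the new addition $\dotplus$ given by $a_1^\circ\dotplus a_2^\circ=(a_1+a_2)^\circ=a_1^\circ+a_2^\circ$ if $a_1^\circ\ne a_2^\circ$, and $a_1^\circ\dotplus a_2^\circ=a_1^\circ$ if $a_1^\circ=a_2^\circ$. (b) There is a $\mathcal T$-modulus $\mu:\mathcal A\to\mathcal T_0^\odot$ given by $\mu(c)=c_{\mathcal T}^\circ$. (c) When $(\mathcal A,\mathcal A_0)$ is of the second kind, $\dotplus$ is the same addition as the given addition in $\mathcal A_0$, so the map $\mu:\mathcal A\to\mathcal A_0$ given by $\mu(b)=b^\circ$ is a $\mathcal T$-modulus. (iii) With respect to the original operations, suppose $(\mathcal A,\mathcal A_0)$ is $\mathcal A_0$-bipotent of the first kind. (a) When $(\mathcal A,\mathcal A_0)$ has period $m$, $m\mathcal T_0=\{ma:a\in\mathcal T_0\}$ is a bipotent sub-semiring of $\mathcal A$, and there is a $\mathcal T$-modulus $\mu:\mathcal A\to m\mathcal T_0$ given by $\mu(ka)=ma$ for all $a\in\mathcal T$ and all integers $k\ge1$ (and $\mu(0)=0$). (b) When $\mathcal A$ has characteristic $(1,2)$, $\mathcal A$ has the $\mathcal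 T$-modulus $\mu:\mathcal A\to\mathcal A^\circ\subseteq\mathcal A_0$ given by $\mu(b)=b_{\mathcal T}^\circ$; in other words, $\mu(ka)=a+a=a^\circ$ for all $a\in\mathcal T$ and $1<k\in\mathbb N$.
   Context: Let $\mathcal T$ be a set with a distinguished element $1$. A left $\mathcal T$-module is a commutative additive semigroup $(\mathcal A,+,0)$ with zero element and a left action of $\mathcal T$ with $a0=0$, $a(b_1+b_2)=ab_1+ab_2$, $1b=b$; right modules are analogous; a $\mathcal T$-bimodule is both, with $(a_1b)a_2=a_1(ba_2)$. $\mathcal T_0=\mathcal T\cup\{0\}$ ($0\notin\mathcal T$). $\mathcal A$ is weakly admissible if $\mathcal T_0\subseteq\mathcal A$ and both actions of $a\in\mathcal T$ on $1$ give $a$; admissible if moreover $\mathcal T_0$ spans $(\mathcal A,+)$. A pair $(\mathcal A,\mathcal A_0)$ is a bimodule with a sub-bimodule $\mathcal A_0$; (weakly) admissible if $\mathcal A$ is and $\mathcal A_0\cap\mathcal T_0=\{0\}$. It is a mon-pair if $\mathcal T$ is a multiplicative monoid with unit $1$ and $(a_1a_2)b=a_1(a_2b)$. In an admissible mon-pair, $\mathcal A$ is given the multiplication $(\sum_i a_i)(\sum_j a'_j)=\sum_{i,j}a_ia'_j$ for $a_i,a_j'\in\mathcal T$. Standing assumptions: for $a\in\mathcal T$, $b\in\mathcal A$, $ab\in\mathcal A_0$ or $ba\in\mathcal A_0$ implies $b\in\mathcal A_0$; $ab_1=ab_2$ or $b_1a=b_2a$ implies $b_1=b_2$. First kind: $1+1\in\mathcal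 A_0$; second kind: $a+a\notin\mathcal A_0$ for all $a\in\mathcal T$. Weak Property N: there is $1^\dag\in\mathcal T$ with $1+1^\dag\in\mathcal A_0$, $1^\dag\mathcal T\subseteq\mathcal T$, $1^\dag b=b1^\dag$ for all $b$; put $b^\dag=b1^\dag$, $b^\circ=b+b^\dag$, $\mathcal A^\circ=\{b^\circ:b\in\mathcal A\}$. Property N: moreover $a_1+a_2=a_1^\circ$ whenever $a_1,a_2\in\mathcal T$, $a_1+a_2\in\mathcal A_0$. Metatangible: admissible, Property N, and $a_1+a_2\in\mathcal T\cup\mathcal A_0$ for $a_1,a_2\in\mathcal T$. $\mathcal A_0$-bipotent: metatangible with $a_1+a_2\in\{a_1,a_2\}\cup\mathcal A_0$ for $a_1,a_2\in\mathcal T$. $\mathcal T_0^\odot$ is the set $\{a^\circ:a\in\mathcal T_0\}$ with the operation $a_1^\circ\odot a_2^\circ=(a_1a_2)^\circ$. Uniform presentation: for a metatangible pair, every nonzero $c\in\mathcal A$, with height $m_c$ (the minimal number of elements of $\mathcal T$ summing to $c$), has some $c_{\mathcal T}\in\mathcal T$ such that: for the first kind, $c=m_cc_{\mathcal T}$; for the second kind, $c=c_{\mathcal T}$ or $c=c_{\mathcal T}^\circ$. This is the meaning of $c_{\mathcal T}$; the modulus sends $0$ to $0$. A homomorphism from a weakly admissible $\mathcal T$-module $\mathcal A$ to a weakly admissible $\mathcal T'$-module $\mathcal A'$ is an additive homomorphism $\mu$ with $\mu(1)=1$, $\mu(\mathcal T)\subseteq\mathcal T'$, $\mu(0)=0$,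 $\mu(ab)=\mu(a)\mu(b)$ for $a\in\mathcal T$, $b\in\mathcal A$. A weak modulus from a pair $\mathcal A$ to an additively idempotent $\mathcal T'$-module $\mathcal M$ is a nonzero homomorphism $\mu:\mathcal A\to\mathcal M$ such that $b_1+b_2=b_1$ whenever $\mu(b_1)\neq\mu(b_2)$ and $\mu(b_1)+\mu(b_2)=\mu(b_1)$. It is a modulus when $\mathcal M$ (or the image of $\mu$) is bipotent ($x+y\in\{x,y\}$), ordered by $x\le y$ iff $x+y=y$, and $\mu(a_i)\le\mu(a_i')$ ($i=1,2$) implies $\mu(a_1a_2)\le\mu(a_1'a_2')$ for $a_i,a_i'\in\mathcal T$. It is a $\mathcal T$-modulus when $\mu(\mathcal T)=\mu(\mathcal A\setminus\{0\})$. Here the target is regarded as a module over $\mathcal T'=\mu(\mathcal T)$, with its unit $\mu(1)$. For $k\in\mathbb N$, $kb=b+\dots+b$ ($k$ times). $\mathcal A$ has characteristic $(p,q)$, $p\ge1,q\ge0$, if $p1+q1=q1$ with $p+q$ minimal such; then the period is the smallest $m\ge1$ with $m1+m1=m1$. A semiring is idempotent if $b+b=b$ for all $b$.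
   Formalization: For pairs of the first kind, the existence of the T-modulus in (ii)(b) and (iii)(a) is proved assuming k1≠0 for all k≥1; otherwise it fails, e.g. A=Z/4, T={1}, A_0={0,2}. *)

theory Defs
  imports "HOL-Algebra.Ring"
begin

section \<open>Modules over a set of tangible elements\<close>

text \<open>
  As in the library's record of modules over a ring, the additive structure is carried by the fields
  \<open>carrier\<close>, \<open>add\<close>, \<open>zero\<close> of the underlying ring record, whose fields \<open>mult\<close> and \<open>one\<close> are not used.
  The field \<open>tangible\<close> holds the acting set \<open>\<T>\<close> and its distinguished element; the product
  \<open>mult (tangible M)\<close> is only constrained for mon-pairs.
\<close>

record ('t, 'a) tbimod = "'a ring" +
  tangible :: "'t monoid"
  lact :: "'t \<Rightarrow> 'a \<Rightarrow> 'a" (infixr "\<triangleright>\<index>" 70)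
  ract :: "'a \<Rightarrow> 't \<Rightarrow> 'a" (infixl "\<triangleleft>\<index>" 70)

abbreviation Tan :: "('t, 'a, 'm) tbimod_scheme \<Rightarrow> 't set"
  where "Tan M \<equiv> carrier (tangible M)"

abbreviation unit_T :: "('t, 'a, 'm) tbimod_scheme \<Rightarrow> 't"
  where "unit_T M \<equiv> \<one>\<^bsub>tangible M\<^esub>"

abbreviation Tan0 :: "('a, 'a, 'm) tbimod_scheme \<Rightarrow> 'a set"
  where "Tan0 M \<equiv> insert \<zero>\<^bsub>M\<^esub> (Tan M)"

locale left_tmodule = abelian_monoid M
  for M :: "('t, 'a, 'm) tbimod_scheme" (structure) +
  assumes unit_T_closed: "unit_T M \<in> Tan M"
    and lact_closed: "\<lbrakk>a \<in> Tan M; b \<in> carrier M\<rbrakk> \<Longrightarrow> a \<triangleright> b \<in> carrier M"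
    and lact_zero: "a \<in> Tan M \<Longrightarrow> a \<triangleright> \<zero> = \<zero>"
    and lact_add: "\<lbrakk>a \<in> Tan M; b1 \<in> carrier M; b2 \<in> carrier M\<rbrakk>
      \<Longrightarrow> a \<triangleright> (b1 \<oplus> b2) = a \<triangleright> b1 \<oplus> a \<triangleright> b2"
    and lact_unit: "b \<in> carrier M \<Longrightarrow> unit_T M \<triangleright> b = b"

locale right_tmodule = abelian_monoid M
  for M :: "('t, 'a, 'm) tbimod_scheme" (structure) +
  assumes unit_T_closed': "unit_T M \<in> Tan M"
    and ract_closed: "\<lbrakk>a \<in> Tan M; b \<in> carrier M\<rbrakk> \<Longrightarrow> b \<triangleleft> a \<in> carrier M"
    and ract_zero: "a \<in> Tan M \<Longrightarrow> \<zero> \<triangleleft> a = \<zero>"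
    and ract_add: "\<lbrakk>a \<in> Tan M; b1 \<in> carrier M; b2 \<in> carrier M\<rbrakk>
      \<Longrightarrow> (b1 \<oplus> b2) \<triangleleft> a = b1 \<triangleleft> a \<oplus> b2 \<triangleleft> a"
    and ract_unit: "b \<in> carrier M \<Longrightarrow> b \<triangleleft> unit_T M = b"

locale tbimodule = left_tmodule M + right_tmodule M
  for M :: "('t, 'a, 'm) tbimod_scheme" (structure) +
  assumes act_compat: "\<lbrakk>a1 \<in> Tan M; a2 \<in> Tan M; b \<in> carrier M\<rbrakk>
      \<Longrightarrow> (a1 \<triangleright> b) \<triangleleft> a2 = a1 \<triangleright> (b \<triangleleft> a2)"

locale weakly_admissible = tbimodule M
  for M :: "('a, 'a, 'm) tbimod_scheme" (structure) +
  assumes zero_not_tangible: "\<zero> \<notin> Tan M"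
    and tangible_subset: "Tan M \<subseteq> carrier M"
    and lact_on_unit: "a \<in> Tan M \<Longrightarrow> a \<triangleright> unit_T M = a"
    and ract_on_unit: "a \<in> Tan M \<Longrightarrow> unit_T M \<triangleleft> a = a"

definition lsum :: "('a, 'm) ring_scheme \<Rightarrow> 'a list \<Rightarrow> 'a"
  where "lsum R xs = foldr (add R) xs \<zero>\<^bsub>R\<^esub>"

locale admissible = weakly_admissible M
  for M :: "('a, 'a, 'm) tbimod_scheme" (structure) +
  assumes spanned: "b \<in> carrier M \<Longrightarrow> \<exists>xs. set xs \<subseteq> Tan0 M \<and> b = lsum M xs"

section \<open>Pairs\<close>

locale tpair = tbimodule M
  for M :: "('t, 'a, 'm) tbimod_scheme" (structure) and A0 :: "'a set" +
  assumes A0_subset: "A0 \<subseteq> carrier M"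
    and A0_zero: "\<zero> \<in> A0"
    and A0_add: "\<lbrakk>b1 \<in> A0; b2 \<in> A0\<rbrakk> \<Longrightarrow> b1 \<oplus> b2 \<in> A0"
    and A0_lact: "\<lbrakk>a \<in> Tan M; b \<in> A0\<rbrakk> \<Longrightarrow> a \<triangleright> b \<in> A0"
    and A0_ract: "\<lbrakk>a \<in> Tan M; b \<in> A0\<rbrakk> \<Longrightarrow> b \<triangleleft> a \<in> A0"

locale admissible_pair = admissible M + tpair M A0
  for M :: "('a, 'a, 'm) tbimod_scheme" (structure) and A0 :: "'a set" +
  assumes A0_Int_Tan0: "A0 \<inter> Tan0 M = {\<zero>}"

locale mon_pair = tpair M A0
  for M :: "('t, 'a, 'm) tbimod_scheme" (structure) and A0 :: "'a set" +
  assumes tangible_monoid: "monoid (tangible M)"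
    and lact_assoc: "\<lbrakk>a1 \<in> Tan M; a2 \<in> Tan M; b \<in> carrier M\<rbrakk>
      \<Longrightarrow> (a1 \<otimes>\<^bsub>tangible M\<^esub> a2) \<triangleright> b = a1 \<triangleright> (a2 \<triangleright> b)"

text \<open>The standing assumptions: tangible elements reflect membership in \<open>A0\<close> and are cancellable.\<close>

locale cancellative_pair = tpair M A0
  for M :: "('t, 'a, 'm) tbimod_scheme" (structure) and A0 :: "'a set" +
  assumes lact_reflect: "\<lbrakk>a \<in> Tan M; b \<in> carrier M; a \<triangleright> b \<in> A0\<rbrakk> \<Longrightarrow> b \<in> A0"
    and ract_reflect: "\<lbrakk>a \<in> Tan M; b \<in> carrier M; b \<triangleleft> a \<in> A0\<rbrakk> \<Longrightarrow> b \<in> A0"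
    and lact_cancel: "\<lbrakk>a \<in> Tan M; b1 \<in> carrier M; b2 \<in> carrier M; a \<triangleright> b1 = a \<triangleright> b2\<rbrakk> \<Longrightarrow> b1 = b2"
    and ract_cancel: "\<lbrakk>a \<in> Tan M; b1 \<in> carrier M; b2 \<in> carrier M; b1 \<triangleleft> a = b2 \<triangleleft> a\<rbrakk> \<Longrightarrow> b1 = b2"

definition first_kind :: "('a, 'a, 'm) tbimod_scheme \<Rightarrow> 'a set \<Rightarrow> bool"
  where "first_kind M A0 \<longleftrightarrow> unit_T M \<oplus>\<^bsub>M\<^esub> unit_T M \<in> A0"

definition second_kind :: "('a, 'a, 'm) tbimod_scheme \<Rightarrow> 'a set \<Rightarrow> bool"
  where "second_kind M A0 \<longleftrightarrow> (\<forall>a\<in>Tan M. a \<oplus>\<^bsub>M\<^esub> a \<notin> A0)"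

text \<open>Throughout, \<open>d\<close> is the element \<open>1\<^sup>\<dagger>\<close> of Property N, and \<open>circ M d b\<close> is \<open>b\<^sup>\<circ> = b + b 1\<^sup>\<dagger>\<close>.\<close>

definition circ :: "('a, 'a, 'm) tbimod_scheme \<Rightarrow> 'a \<Rightarrow> 'a \<Rightarrow> 'a"
  where "circ M d b = b \<oplus>\<^bsub>M\<^esub> (b \<triangleleft>\<^bsub>M\<^esub> d)"

locale weak_property_N = weakly_admissible M + tpair M A0
  for M :: "('a, 'a, 'm) tbimod_scheme" (structure) and A0 :: "'a set" and d :: 'a +
  assumes dag_tangible: "d \<in> Tan M"
    and unit_add_dag: "unit_T M \<oplus> d \<in> A0"
    and dag_lact_tangible: "a \<in> Tan M \<Longrightarrow> d \<triangleright> a \<in> Tan M"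
    and dag_central: "b \<in> carrier M \<Longrightarrow> d \<triangleright> b = b \<triangleleft> d"

locale property_N = weak_property_N M A0 d
  for M :: "('a, 'a, 'm) tbimod_scheme" (structure) and A0 :: "'a set" and d :: 'a +
  assumes add_eq_circ: "\<lbrakk>a1 \<in> Tan M; a2 \<in> Tan M; a1 \<oplus> a2 \<in> A0\<rbrakk> \<Longrightarrow> a1 \<oplus> a2 = circ M d a1"

locale metatangible_pair =
  admissible_pair M A0 + cancellative_pair M A0 + property_N M A0 d
  for M :: "('a, 'a, 'm) tbimod_scheme" (structure) and A0 :: "'a set" and d :: 'a +
  assumes metatangible: "\<lbrakk>a1 \<in> Tan M; a2 \<in> Tan M\<rbrakk> \<Longrightarrow> a1 \<oplus> a2 \<in> Tan M \<union> A0"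

locale metatangible_mon_pair = metatangible_pair M A0 d + mon_pair M A0
  for M :: "('a, 'a, 'm) tbimod_scheme" (structure) and A0 :: "'a set" and d :: 'a

definition A0_bipotent :: "('a, 'a, 'm) tbimod_scheme \<Rightarrow> 'a set \<Rightarrow> 'a \<Rightarrow> bool"
  where "A0_bipotent M A0 d \<longleftrightarrow> metatangible_pair M A0 d \<and>
    (\<forall>a1\<in>Tan M. \<forall>a2\<in>Tan M. a1 \<oplus>\<^bsub>M\<^esub> a2 \<in> {a1, a2} \<union> A0)"

section \<open>Height, uniform presentation, characteristic\<close>

definition height :: "('a, 'a, 'm) tbimod_scheme \<Rightarrow> 'a \<Rightarrow> nat"
  where "height M c = (LEAST n. \<exists>xs. length xs = n \<and> set xs \<subseteq> Tan M \<and> lsum M xs = c)"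

text \<open>\<open>uniform_rep M A0 d c a\<close> says that \<open>a\<close> is an admissible choice of \<open>c\<^sub>\<T>\<close>.\<close>

definition uniform_rep :: "('a, 'a, 'm) tbimod_scheme \<Rightarrow> 'a set \<Rightarrow> 'a \<Rightarrow> 'a \<Rightarrow> 'a \<Rightarrow> bool"
  where "uniform_rep M A0 d c a \<longleftrightarrow> a \<in> Tan M \<and>
    (first_kind M A0 \<longrightarrow> c = [height M c] \<cdot>\<^bsub>M\<^esub> a) \<and>
    (second_kind M A0 \<longrightarrow> c = a \<or> c = circ M d a)"

definition char_rel :: "('a, 'a, 'm) tbimod_scheme \<Rightarrow> nat \<Rightarrow> nat \<Rightarrow> bool"
  where "char_rel M p q \<longleftrightarrow> p \<ge> 1 \<and>
    [p] \<cdot>\<^bsub>M\<^esub> unit_T M \<oplus>\<^bsub>M\<^esub> [q] \<cdot>\<^bsub>M\<^esub> unit_T M = [q] \<cdot>\<^bsub>M\<^esub> unit_T M"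

definition has_characteristic :: "('a, 'a, 'm) tbimod_scheme \<Rightarrow> nat \<Rightarrow> nat \<Rightarrow> bool"
  where "has_characteristic M p q \<longleftrightarrow> char_rel M p q \<and>
    (\<forall>p' q'. char_rel M p' q' \<longrightarrow> p + q \<le> p' + q')"

definition has_period :: "('a, 'a, 'm) tbimod_scheme \<Rightarrow> nat \<Rightarrow> bool"
  where "has_period M m \<longleftrightarrow> (\<exists>p q. has_characteristic M p q) \<and> m \<ge> 1 \<and>
    [m] \<cdot>\<^bsub>M\<^esub> unit_T M \<oplus>\<^bsub>M\<^esub> [m] \<cdot>\<^bsub>M\<^esub> unit_T M = [m] \<cdot>\<^bsub>M\<^esub> unit_T M \<and>
    (\<forall>k\<ge>1. [k] \<cdot>\<^bsub>M\<^esub> unit_T M \<oplus>\<^bsub>M\<^esub> [k] \<cdot>\<^bsub>M\<^esub> unit_T M = [k] \<cdot>\<^bsub>M\<^esub> unit_T M \<longrightarrow> m \<le> k)"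

text \<open>
  Without this condition an \<open>A0\<close>-bipotent pair can be a cyclic group of even order, with \<open>\<T> = {1}\<close>
  and \<open>A0\<close> the subgroup of even elements; such a pair is of the first kind and \<open>c \<mapsto> c\<^sub>\<T>\<^sup>\<circ>\<close> is not
  additive, since a sum of nonzero elements can be \<open>0\<close>. It is automatic for \<open>A0\<close>-bipotent pairs of
  the second kind and in characteristic \<open>(p, q)\<close> with \<open>q \<ge> 1\<close>.
\<close>

definition unit_multiples_nonzero :: "('a, 'a, 'm) tbimod_scheme \<Rightarrow> bool"
  where "unit_multiples_nonzero M \<longleftrightarrow> (\<forall>k::nat. k \<ge> 1 \<longrightarrow> [k] \<cdot>\<^bsub>M\<^esub> unit_T M \<noteq> \<zero>\<^bsub>M\<^esub>)"

section \<open>Semirings attached to a pair\<close>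

definition idempotent_on :: "('a, 'm) ring_scheme \<Rightarrow> 'a set \<Rightarrow> bool"
  where "idempotent_on R S \<longleftrightarrow> (\<forall>x\<in>S. x \<oplus>\<^bsub>R\<^esub> x = x)"

definition bipotent_on :: "('a, 'm) ring_scheme \<Rightarrow> 'a set \<Rightarrow> bool"
  where "bipotent_on R S \<longleftrightarrow> (\<forall>x\<in>S. \<forall>y\<in>S. x \<oplus>\<^bsub>R\<^esub> y \<in> {x, y})"

text \<open>The product of two sums of tangible elements in an admissible mon-pair; it does not depend on
  the chosen presentations.\<close>

definition amult :: "('a, 'a, 'm) tbimod_scheme \<Rightarrow> 'a \<Rightarrow> 'a \<Rightarrow> 'a"
  where "amult M x y = (THE z. \<exists>xs ys. set xs \<subseteq> Tan M \<and> set ys \<subseteq> Tan M \<and>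
    x = lsum M xs \<and> y = lsum M ys \<and>
    z = lsum M [a \<otimes>\<^bsub>tangible M\<^esub> a'. a \<leftarrow> xs, a' \<leftarrow> ys])"

definition semiring_of :: "('a, 'a, 'm) tbimod_scheme \<Rightarrow> 'a ring"
  where "semiring_of M =
    \<lparr>carrier = carrier M, mult = amult M, one = unit_T M, zero = \<zero>\<^bsub>M\<^esub>, add = add M\<rparr>"

abbreviation restrict_semiring :: "'a ring \<Rightarrow> 'a set \<Rightarrow> 'a \<Rightarrow> 'a ring"
  where "restrict_semiring R S u \<equiv> R\<lparr>carrier := S, one := u\<rparr>"

text \<open>A sub-semiring may have a unit \<open>u\<close> different from that of the ambient semiring.\<close>

definition sub_semiring :: "'a ring \<Rightarrow> 'a set \<Rightarrow> 'a \<Rightarrow> bool"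
  where "sub_semiring R S u \<longleftrightarrow>
    semiring R \<and> S \<subseteq> carrier R \<and> \<zero>\<^bsub>R\<^esub> \<in> S \<and> semiring (restrict_semiring R S u)"

definition Tan0_monoid :: "('a, 'a, 'm) tbimod_scheme \<Rightarrow> 'a monoid"
  where "Tan0_monoid M =
    \<lparr>carrier = Tan0 M,
     mult = (\<lambda>x y. if x = \<zero>\<^bsub>M\<^esub> \<or> y = \<zero>\<^bsub>M\<^esub> then \<zero>\<^bsub>M\<^esub> else x \<otimes>\<^bsub>tangible M\<^esub> y),
     one = unit_T M\<rparr>"

definition odot :: "('a, 'a, 'm) tbimod_scheme \<Rightarrow> 'a \<Rightarrow> 'a \<Rightarrow> 'a \<Rightarrow> 'a"
  where "odot M d x y = (THE z. \<exists>a1\<in>Tan0 M. \<exists>a2\<in>Tan0 M.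
    x = circ M d a1 \<and> y = circ M d a2 \<and> z = circ M d (a1 \<otimes>\<^bsub>Tan0_monoid M\<^esub> a2))"

definition dotplus :: "('a, 'a, 'm) tbimod_scheme \<Rightarrow> 'a \<Rightarrow> 'a \<Rightarrow> 'a"
  where "dotplus M x y = (if x = y then x else x \<oplus>\<^bsub>M\<^esub> y)"

definition Todot_monoid :: "('a, 'a, 'm) tbimod_scheme \<Rightarrow> 'a \<Rightarrow> 'a monoid"
  where "Todot_monoid M d =
    \<lparr>carrier = circ M d ` Tan0 M, mult = odot M d, one = circ M d (unit_T M)\<rparr>"

definition Todot_semiring :: "('a, 'a, 'm) tbimod_scheme \<Rightarrow> 'a \<Rightarrow> 'a ring"
  where "Todot_semiring M d =
    \<lparr>carrier = circ M d ` Tan0 M, mult = odot M d, one = circ M d (unit_T M),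
     zero = circ M d \<zero>\<^bsub>M\<^esub>, add = dotplus M\<rparr>"

section \<open>Moduli\<close>

definition tmod_hom ::
  "('a, 'a, 'm) tbimod_scheme \<Rightarrow> ('b, 'b, 'n) tbimod_scheme \<Rightarrow> ('a \<Rightarrow> 'b) \<Rightarrow> bool"
  where "tmod_hom M N \<mu> \<longleftrightarrow> weakly_admissible M \<and> weakly_admissible N \<and>
    \<mu> \<in> carrier M \<rightarrow> carrier N \<and>
    (\<forall>b1\<in>carrier M. \<forall>b2\<in>carrier M. \<mu> (b1 \<oplus>\<^bsub>M\<^esub> b2) = \<mu> b1 \<oplus>\<^bsub>N\<^esub> \<mu> b2) \<and>
    \<mu> (unit_T M) = unit_T N \<and> \<mu> ` Tan M \<subseteq> Tan N \<and> \<mu> \<zero>\<^bsub>M\<^esub> = \<zero>\<^bsub>N\<^esub> \<and>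
    (\<forall>a\<in>Tan M. \<forall>b\<in>carrier M. \<mu> (a \<triangleright>\<^bsub>M\<^esub> b) = \<mu> a \<triangleright>\<^bsub>N\<^esub> \<mu> b)"

definition weak_modulus ::
  "('a, 'a, 'm) tbimod_scheme \<Rightarrow> ('b, 'b, 'n) tbimod_scheme \<Rightarrow> ('a \<Rightarrow> 'b) \<Rightarrow> bool"
  where "weak_modulus M N \<mu> \<longleftrightarrow> tmod_hom M N \<mu> \<and> idempotent_on N (carrier N) \<and>
    (\<exists>b\<in>carrier M. \<mu> b \<noteq> \<zero>\<^bsub>N\<^esub>) \<and>
    (\<forall>b1\<in>carrier M. \<forall>b2\<in>carrier M.
      \<mu> b1 \<noteq> \<mu> b2 \<and> \<mu> b1 \<oplus>\<^bsub>N\<^esub> \<mu> b2 = \<mu> b1 \<longrightarrow> b1 \<oplus>\<^bsub>M\<^esub> b2 = b1)"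

definition add_le :: "('a, 'm) ring_scheme \<Rightarrow> 'a \<Rightarrow> 'a \<Rightarrow> bool"
  where "add_le R x y \<longleftrightarrow> x \<oplus>\<^bsub>R\<^esub> y = y"

text \<open>Bipotence of the whole target implies bipotence of the image, so requiring the latter covers
  both variants of the notion. Products of tangible elements are taken in \<open>\<T>\<close>.\<close>

definition modulus ::
  "('a, 'a, 'm) tbimod_scheme \<Rightarrow> ('b, 'b, 'n) tbimod_scheme \<Rightarrow> ('a \<Rightarrow> 'b) \<Rightarrow> bool"
  where "modulus M N \<mu> \<longleftrightarrow> weak_modulus M N \<mu> \<and> bipotent_on N (\<mu> ` carrier M) \<and>
    (\<forall>a1\<in>Tan M. \<forall>a2\<in>Tan M. \<forall>a1'\<in>Tan M. \<forall>a2'\<in>Tan M.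
      add_le N (\<mu> a1) (\<mu> a1') \<and> add_le N (\<mu> a2) (\<mu> a2') \<longrightarrow>
      add_le N (\<mu> (a1 \<otimes>\<^bsub>tangible M\<^esub> a2)) (\<mu> (a1' \<otimes>\<^bsub>tangible M\<^esub> a2')))"

definition T_modulus ::
  "('a, 'a, 'm) tbimod_scheme \<Rightarrow> ('b, 'b, 'n) tbimod_scheme \<Rightarrow> ('a \<Rightarrow> 'b) \<Rightarrow> bool"
  where "T_modulus M N \<mu> \<longleftrightarrow> modulus M N \<mu> \<and> \<mu> ` Tan M = \<mu> ` (carrier M - {\<zero>\<^bsub>M\<^esub>})"

text \<open>The structure \<open>R\<close> regarded as a bimodule over \<open>\<T>' = \<mu>(\<T>)\<close> with unit \<open>\<mu>(1)\<close>, acting by the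
  multiplication of \<open>R\<close>.\<close>

definition target_module ::
  "('a, 'a, 'm) tbimod_scheme \<Rightarrow> 'b ring \<Rightarrow> ('a \<Rightarrow> 'b) \<Rightarrow> ('b, 'b) tbimod"
  where "target_module M R \<mu> =
    \<lparr>carrier = carrier R, mult = mult R, one = one R, zero = zero R, add = add R,
     tangible = \<lparr>carrier = \<mu> ` Tan M, mult = mult R, one = \<mu> (unit_T M)\<rparr>,
     lact = mult R, ract = mult R\<rparr>"

abbreviation T_modulus_to :: "('a, 'a, 'm) tbimod_scheme \<Rightarrow> 'b ring \<Rightarrow> ('a \<Rightarrow> 'b) \<Rightarrow> bool"
  where "T_modulus_to M R \<mu> \<equiv> T_modulus M (target_module M R \<mu>) \<mu>"

text \<open>\<open>\<mu>(0) = 0\<close> and \<open>\<mu>(c) = c\<^sub>\<T>\<^sup>\<circ>\<close> for \<open>c \<noteq> 0\<close>, where \<open>c\<^sub>\<T>\<close> exists and may be chosen arbitrarily.\<close>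

definition given_by_circ_of_rep ::
  "('a, 'a, 'm) tbimod_scheme \<Rightarrow> 'a set \<Rightarrow> 'a \<Rightarrow> ('a \<Rightarrow> 'a) \<Rightarrow> bool"
  where "given_by_circ_of_rep M A0 d \<mu> \<longleftrightarrow> \<mu> \<zero>\<^bsub>M\<^esub> = \<zero>\<^bsub>M\<^esub> \<and>
    (\<forall>c\<in>carrier M - {\<zero>\<^bsub>M\<^esub>}. (\<exists>a. uniform_rep M A0 d c a) \<and>
      (\<forall>a. uniform_rep M A0 d c a \<longrightarrow> \<mu> c = circ M d a))"

end

theory Submission
  imports Defs
begin

text \<open>
  Write \<open>1\<degree> = 1 + 1\<^sup>\<dagger>\<close>. For tangible \<open>a\<close> one has \<open>a\<degree> = a 1\<degree> = 1\<degree> a\<close>, and \<open>\<degree>\<close> commutes with both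
  actions. So \<open>(a b)\<degree>\<close> depends on each factor only through its circle value, which gives the
  monoid homomorphism (\<open>circ_mult_cong\<close>, \<open>odot_circ\<close>).

  The rest concerns bipotent pairs. If \<open>a + b\<close> lies in \<open>\<A>\<^sub>0\<close>, Property N forces
  \<open>a + b = a\<degree> = b\<degree>\<close>. Hence tangible elements with different circle values never produce anything
  new: one of them absorbs the other, and which one does is decided by the circle values
  (\<open>absorb_transfer\<close>). This makes \<open>\<T>\<^sub>0\<^sup>\<odot>\<close> an idempotent, even bipotent, semiring
  (\<open>semiring_Todot\<close>), and it controls all of \<open>\<A>\<close>. Call a nonempty sum of tangible elements with
  a common circle value \<open>a\<degree>\<close> homogeneous for \<open>a\<close>. The terms of smaller value in an arbitrary sum
  are absorbed, so every nonzero element is homogeneous for some \<open>a\<close> (\<open>homogeneous_exists\<close>), and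
  absorption passes from tangible elements to homogeneous sums (\<open>homogeneous_absorb\<close>). The value
  \<open>a\<degree>\<close> is determined by the element (\<open>homogeneous_unique\<close>): an element with two values would be
  idempotent, absorb one tangible element and be absorbed by another; in the first kind this
  leads, after cancellation, to \<open>1 + 1 = 1\<close>, which is impossible since \<open>1 + 1\<close> belongs to \<open>\<A>\<^sub>0\<close>.
  In the second kind a nonzero element is tangible or a circle value, but not both, and uniqueness
  is immediate.

  Consequently a map that is constant on the elements homogeneous for \<open>a\<close> is a modulus as soon as
  it behaves well on \<open>\<T>\<close> and no homogeneous element vanishes; this criterion
  (\<open>T_modulus_homogeneous\<close>) is applied to the targets \<open>\<T>\<^sub>0\<^sup>\<odot>\<close>, \<open>\<A>\<^sub>0\<close> and \<open>m \<T>\<^sub>0\<close>. For the last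
  one, \<open>m a\<close> depends only on \<open>a\<degree> = a + a\<close>, since \<open>m a = m a + m a = m (a + a)\<close>. Characteristic
  \<open>(1, 2)\<close> is the case of period \<open>2\<close>, where \<open>2 a = a\<degree>\<close>. Uniform presentations are particular
  homogeneous sums (\<open>homogeneous_of_uniform_rep\<close>, \<open>uniform_rep_exists\<close>), so the moduli take the
  prescribed values on them.
\<close>


section \<open>Sums of lists\<close>

context abelian_monoid
begin

lemma lsum_Nil [simp]: "lsum G [] = \<zero>"
  by (simp add: lsum_def)

lemma lsum_Cons [simp]: "lsum G (x # xs) = x \<oplus> lsum G xs"
  by (simp add: lsum_def)

lemma lsum_closed: "set xs \<subseteq> carrier G \<Longrightarrow> lsum G xs \<in> carrier G"
  by (induction xs) auto

lemma lsum_append: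
  "\<lbrakk>set xs \<subseteq> carrier G; set ys \<subseteq> carrier G\<rbrakk> \<Longrightarrow> lsum G (xs @ ys) = lsum G xs \<oplus> lsum G ys"
  by (induction xs) (auto simp: lsum_closed a_assoc)

lemma lsum_map_additive:
  assumes "\<And>x. x \<in> carrier G \<Longrightarrow> f x \<in> carrier G"
    and "f \<zero> = \<zero>"
    and "\<And>x y. \<lbrakk>x \<in> carrier G; y \<in> carrier G\<rbrakk> \<Longrightarrow> f (x \<oplus> y) = f x \<oplus> f y"
  shows "set xs \<subseteq> carrier G \<Longrightarrow> f (lsum G xs) = lsum G (map f xs)"
  by (induction xs) (auto simp: assms lsum_closed)

lemma lsum_map_add:
  assumes "\<And>x. x \<in> set xs \<Longrightarrow> f x \<in> carrier G" "\<And>x. x \<in> set xs \<Longrightarrow> g x \<in> carrier G"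
  shows "lsum G (map (\<lambda>x. f x \<oplus> g x) xs) = lsum G (map f xs) \<oplus> lsum G (map g xs)"
  using assms
proof (induction xs)
  case (Cons x xs)
  have "lsum G (map f xs) \<in> carrier G" "lsum G (map g xs) \<in> carrier G"
    by (rule lsum_closed, use Cons.prems in auto)+
  with Cons show ?case by (simp add: a_ac)
qed simp

lemma lsum_remove1:
  "\<lbrakk>set xs \<subseteq> carrier G; x \<in> set xs\<rbrakk> \<Longrightarrow> lsum G xs = x \<oplus> lsum G (remove1 x xs)"
proof (induction xs)
  case (Cons y xs)
  have "lsum G (remove1 x xs) \<in> carrier G"
    using Cons.prems set_remove1_subset[of x xs] by (intro lsum_closed) auto
  with Cons show ?case by (auto simp: a_lcomm)
qed simp

lemma lsum_filter_zero:
  "set xs \<subseteq> carrier G \<Longrightarrow> lsum G (filter (\<lambda>x. x \<noteq> \<zero>) xs) = lsum G xs"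
  by (induction xs) (auto simp: lsum_closed)

lemma add_pow_additive:
  fixes n :: nat
  assumes "\<And>x. x \<in> carrier G \<Longrightarrow> f x \<in> carrier G"
    and "f \<zero> = \<zero>"
    and "\<And>x y. \<lbrakk>x \<in> carrier G; y \<in> carrier G\<rbrakk> \<Longrightarrow> f (x \<oplus> y) = f x \<oplus> f y"
    and "x \<in> carrier G"
  shows "f ([n] \<cdot> x) = [n] \<cdot> f x"
  by (induction n) (auto simp: assms)

lemma add_pow_idem:
  fixes n :: nat
  assumes "x \<in> carrier G" "x \<oplus> x = x" "n \<ge> 1"
  shows "[n] \<cdot> x = x"
  using assms(3) by (induction n rule: dec_induct) (auto simp: assms)

end


section \<open>The multiplication of an admissible mon-pair\<close>

locale admissible_mon_pair = admissible M + mon_pair M A0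
  for M :: "('a, 'a, 'm) tbimod_scheme" (structure) and A0 :: "'a set"
begin

lemma tangible_closed: "a \<in> Tan M \<Longrightarrow> a \<in> carrier M"
  using tangible_subset by blast

text \<open>Acting on the unit turns the associativity of the action into the identity of the product of
  \<open>\<T>\<close> with the left action; so the product can be written \<open>a \<triangleright> b\<close> throughout.\<close>

lemma tangible_mult:
  assumes "a \<in> Tan M" "b \<in> Tan M"
  shows "a \<otimes>\<^bsub>tangible M\<^esub> b = a \<triangleright> b"
proof -
  have "a \<otimes>\<^bsub>tangible M\<^esub> b \<in> Tan M"
    using tangible_monoid assms by (simp add: monoid.m_closed)
  then show ?thesis
    using lact_assoc[OF assms, of "unit_T M"] assms unit_T_closed
    by (simp add: lact_on_unit tangible_closed)
qed

lemma tangible_lact_closed: "\<lbrakk>a \<in> Tan M; b \<in> Tan M\<rbrakk> \<Longrightarrow> a \<triangleright> b \<in> Tan M"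
  using tangible_mult tangible_monoid by (metis monoid.m_closed)

lemma ract_eq_lact:
  assumes "a \<in> Tan M" "b \<in> Tan M"
  shows "a \<triangleleft> b = a \<triangleright> b"
  using act_compat[OF assms tangible_closed[OF unit_T_closed]] assms
  by (simp add: lact_on_unit ract_on_unit)

lemma lact_lact:
  "\<lbrakk>a \<in> Tan M; b \<in> Tan M; x \<in> carrier M\<rbrakk> \<Longrightarrow> a \<triangleright> (b \<triangleright> x) = (a \<triangleright> b) \<triangleright> x"
  using lact_assoc tangible_mult by metis

lemma lact_lsum:
  "\<lbrakk>a \<in> Tan M; set xs \<subseteq> carrier M\<rbrakk> \<Longrightarrow> a \<triangleright> lsum M xs = lsum M (map (\<lambda>x. a \<triangleright> x) xs)"
  by (rule lsum_map_additive) (auto simp: lact_closed lact_zero lact_add)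

lemma lact_add_pow:
  fixes n :: nat
  shows "\<lbrakk>a \<in> Tan M; x \<in> carrier M\<rbrakk> \<Longrightarrow> a \<triangleright> ([n] \<cdot> x) = [n] \<cdot> (a \<triangleright> x)"
  by (rule add_pow_additive) (auto simp: lact_closed lact_zero lact_add)

lemma obtain_tangible_list:
  assumes "x \<in> carrier M"
  obtains xs where "set xs \<subseteq> Tan M" "x = lsum M xs"
proof -
  obtain ys where ys: "set ys \<subseteq> Tan0 M" "x = lsum M ys"
    using spanned[OF assms] by blast
  moreover from ys(1) have "set ys \<subseteq> carrier M"
    using tangible_subset by auto
  ultimately show ?thesis
    using that[of "filter (\<lambda>y. y \<noteq> \<zero>) ys"] by (auto simp: lsum_filter_zero)
qed

lemma carrier_induct [consumes 1, case_names zero add]: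
  assumes "x \<in> carrier M"
    and "P \<zero>"
    and "\<And>a x. \<lbrakk>a \<in> Tan M; x \<in> carrier M; P x\<rbrakk> \<Longrightarrow> P (a \<oplus> x)"
  shows "P x"
proof -
  obtain xs where xs: "set xs \<subseteq> Tan M" "x = lsum M xs"
    using obtain_tangible_list[OF assms(1)] .
  have "P (lsum M xs)"
    using xs(1)
  proof (induction xs)
    case (Cons a xs)
    then show ?case
      using tangible_subset by (auto intro!: assms(3) lsum_closed)
  qed (simp add: assms(2))
  with xs(2) show ?thesis by simp
qed

lemma lsum_products_left:
  assumes "set xs \<subseteq> Tan M" "set ys \<subseteq> Tan M"
  shows "lsum M [a \<otimes>\<^bsub>tangible M\<^esub> b. a \<leftarrow> xs, b \<leftarrow> ys] = lsum M (map (\<lambda>a. a \<triangleright> lsum M ys) xs)"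
  using assms(1)
proof (induction xs)
  case (Cons a xs)
  have ys: "set ys \<subseteq> carrier M"
    using assms(2) tangible_subset by blast
  have eq: "map (\<lambda>b. a \<otimes>\<^bsub>tangible M\<^esub> b) ys = map (\<lambda>b. a \<triangleright> b) ys"
    using Cons.prems assms(2) by (simp add: tangible_mult subset_iff)
  have closed: "set (map (\<lambda>b. a \<triangleright> b) ys) \<subseteq> carrier M"
      "set [a \<otimes>\<^bsub>tangible M\<^esub> b. a \<leftarrow> xs, b \<leftarrow> ys] \<subseteq> carrier M"
    using Cons.prems assms(2)
    by (auto simp: tangible_mult tangible_lact_closed tangible_closed subset_iff)
  show ?case
    using Cons lsum_append[OF closed] ys by (simp add: eq lact_lsum)
qed simp

lemma lsum_products_right:
  assumes "set xs \<subseteq> Tan M" "set ys \<subseteq> Tan M"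
  shows "lsum M [a \<otimes>\<^bsub>tangible M\<^esub> b. a \<leftarrow> xs, b \<leftarrow> ys] = lsum M (map (\<lambda>b. lsum M xs \<triangleleft> b) ys)"
  unfolding lsum_products_left[OF assms] using assms(1)
proof (induction xs)
  case Nil
  have "lsum M (map (\<lambda>b. \<zero> \<triangleleft> b) ys) = \<zero>"
    using assms(2) by (induction ys) (auto simp: ract_zero)
  then show ?case by simp
next
  case (Cons a xs)
  have ys: "set ys \<subseteq> carrier M" and xs: "lsum M xs \<in> carrier M" and a: "a \<in> carrier M"
    using assms(2) Cons.prems tangible_subset by (auto intro!: lsum_closed)
  have "map (\<lambda>b. lsum M (a # xs) \<triangleleft> b) ys = map (\<lambda>b. a \<triangleright> b \<oplus> lsum M xs \<triangleleft> b) ys"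
    using assms(2) Cons.prems a xs
    by (intro map_cong refl) (simp add: ract_add ract_eq_lact subset_iff)
  also have "lsum M \<dots> = lsum M (map (\<lambda>b. a \<triangleright> b) ys) \<oplus> lsum M (map (\<lambda>b. lsum M xs \<triangleleft> b) ys)"
    using assms(2) Cons.prems xs ys
    by (intro lsum_map_add) (simp_all add: lact_closed ract_closed subset_iff)
  finally have "lsum M (map (\<lambda>b. lsum M (a # xs) \<triangleleft> b) ys)
      = lsum M (map (\<lambda>b. a \<triangleright> b) ys) \<oplus> lsum M (map (\<lambda>b. lsum M xs \<triangleleft> b) ys)" .
  moreover have "lsum M (map (\<lambda>b. a \<triangleright> b) ys) = a \<triangleright> lsum M ys"
    using Cons.prems ys by (simp only: lact_lsum list.set insert_subset)
  moreover have "lsum M (map (\<lambda>a. a \<triangleright> lsum M ys) xs) = lsum M (map (\<lambda>b. lsum M xs \<triangleleft> b) ys)"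
    using Cons by (simp only: list.set insert_subset)
  ultimately show ?case
    by (simp only: list.map lsum_Cons)
qed

text \<open>The products of two presentations can be grouped by rows or by columns; the first grouping
  depends on the right factor only through its sum, the second on the left factor only through its
  sum. Hence the product is independent of both presentations.\<close>

lemma amult_lsum:
  assumes "set xs \<subseteq> Tan M" "set ys \<subseteq> Tan M"
  shows "amult M (lsum M xs) (lsum M ys) = lsum M [a \<otimes>\<^bsub>tangible M\<^esub> b. a \<leftarrow> xs, b \<leftarrow> ys]"
  unfolding amult_def
proof (rule the_equality)
  show "\<exists>us vs. set us \<subseteq> Tan M \<and> set vs \<subseteq> Tan M \<and> lsum M xs = lsum M us \<and> lsum M ys = lsum M vs \<and>
      lsum M [a \<otimes>\<^bsub>tangible M\<^esub> b. a \<leftarrow> xs, b \<leftarrow> ys] = lsum M [a \<otimes>\<^bsub>tangible M\<^esub> b. a \<leftarrow> us, b \<leftarrow> vs]"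
    using assms by blast
next
  fix z
  assume "\<exists>us vs. set us \<subseteq> Tan M \<and> set vs \<subseteq> Tan M \<and> lsum M xs = lsum M us \<and> lsum M ys = lsum M vs \<and>
      z = lsum M [a \<otimes>\<^bsub>tangible M\<^esub> b. a \<leftarrow> us, b \<leftarrow> vs]"
  then obtain us vs where uv: "set us \<subseteq> Tan M" "set vs \<subseteq> Tan M"
      "lsum M xs = lsum M us" "lsum M ys = lsum M vs"
      "z = lsum M [a \<otimes>\<^bsub>tangible M\<^esub> b. a \<leftarrow> us, b \<leftarrow> vs]"
    by blast
  have "z = lsum M [a \<otimes>\<^bsub>tangible M\<^esub> b. a \<leftarrow> us, b \<leftarrow> ys]"
    using uv assms by (simp add: lsum_products_left)
  also have "\<dots> = lsum M [a \<otimes>\<^bsub>tangible M\<^esub> b. a \<leftarrow> xs, b \<leftarrow> ys]"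
    unfolding lsum_products_right[OF uv(1) assms(2)] lsum_products_right[OF assms] uv(3) ..
  finally show "z = lsum M [a \<otimes>\<^bsub>tangible M\<^esub> b. a \<leftarrow> xs, b \<leftarrow> ys]" .
qed

lemma amult_tangible_left:
  assumes "a \<in> Tan M" "y \<in> carrier M"
  shows "amult M a y = a \<triangleright> y"
proof -
  obtain ys where ys: "set ys \<subseteq> Tan M" "y = lsum M ys"
    using obtain_tangible_list[OF assms(2)] .
  have a: "set [a] \<subseteq> Tan M" "a = lsum M [a]"
    using assms by (auto simp: tangible_closed)
  have "amult M a y = lsum M (map (\<lambda>a. a \<triangleright> y) [a])"
    using amult_lsum[OF a(1) ys(1)] lsum_products_left[OF a(1) ys(1)]
    unfolding a(2)[symmetric] ys(2)[symmetric] by (rule trans)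
  then show ?thesis
    using assms by (simp add: lact_closed)
qed

lemma amult_tangible_right:
  assumes "x \<in> carrier M" "a \<in> Tan M"
  shows "amult M x a = x \<triangleleft> a"
proof -
  obtain xs where xs: "set xs \<subseteq> Tan M" "x = lsum M xs"
    using obtain_tangible_list[OF assms(1)] .
  have a: "set [a] \<subseteq> Tan M" "a = lsum M [a]"
    using assms by (auto simp: tangible_closed)
  have "amult M x a = lsum M (map (\<lambda>b. x \<triangleleft> b) [a])"
    using amult_lsum[OF xs(1) a(1)] lsum_products_right[OF xs(1) a(1)]
    unfolding a(2)[symmetric] xs(2)[symmetric] by (rule trans)
  then show ?thesis
    using assms by (simp add: ract_closed)
qed

lemma amult_zero_left:
  assumes "y \<in> carrier M"
  shows "amult M \<zero> y = \<zero>"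
proof -
  obtain ys where "set ys \<subseteq> Tan M" "y = lsum M ys"
    using obtain_tangible_list[OF assms] .
  then show ?thesis
    using amult_lsum[of "[]" ys] by simp
qed

lemma amult_add_left:
  assumes "x \<in> carrier M" "x' \<in> carrier M" "y \<in> carrier M"
  shows "amult M (x \<oplus> x') y = amult M x y \<oplus> amult M x' y"
    and "amult M x y \<in> carrier M"
proof -
  obtain xs where xs: "set xs \<subseteq> Tan M" "x = lsum M xs"
    using obtain_tangible_list[OF assms(1)] .
  obtain xs' where xs': "set xs' \<subseteq> Tan M" "x' = lsum M xs'"
    using obtain_tangible_list[OF assms(2)] .
  obtain ys where ys: "set ys \<subseteq> Tan M" "y = lsum M ys"
    using obtain_tangible_list[OF assms(3)] .
  have closed: "set (map (\<lambda>a. a \<triangleright> y) xs) \<subseteq> carrier M" "set (map (\<lambda>a. a \<triangleright> y) xs') \<subseteq> carrier M"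
    using xs xs' assms(3) by (auto simp: lact_closed subset_iff)
  have xx: "x \<oplus> x' = lsum M (xs @ xs')" "set (xs @ xs') \<subseteq> Tan M"
    using xs xs' tangible_subset by (auto simp: lsum_append)
  have "amult M (x \<oplus> x') y = lsum M (map (\<lambda>a. a \<triangleright> y) (xs @ xs'))"
    using amult_lsum[OF xx(2) ys(1)] lsum_products_left[OF xx(2) ys(1)] xx ys by simp
  also have "\<dots> = lsum M (map (\<lambda>a. a \<triangleright> y) xs) \<oplus> lsum M (map (\<lambda>a. a \<triangleright> y) xs')"
    using closed by (simp add: lsum_append)
  also have "\<dots> = amult M x y \<oplus> amult M x' y"
    using xs xs' ys by (simp add: amult_lsum lsum_products_left)
  finally show "amult M (x \<oplus> x') y = amult M x y \<oplus> amult M x' y" .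
  show "amult M x y \<in> carrier M"
    using xs ys lsum_closed[OF closed(1)] by (simp add: amult_lsum lsum_products_left)
qed

lemmas amult_closed = amult_add_left(2)[OF _ zero_closed]

lemma amult_tangible_assoc:
  assumes "a \<in> Tan M" "y \<in> carrier M" "z \<in> carrier M"
  shows "amult M (a \<triangleright> y) z = a \<triangleright> amult M y z"
  using assms(2)
proof (induction rule: carrier_induct)
  case zero
  then show ?case using assms by (simp add: lact_zero amult_zero_left)
next
  case (add b y)
  then show ?case
    using assms
    by (simp add: lact_add tangible_closed lact_closed amult_add_left(1) amult_closed
        amult_tangible_left tangible_lact_closed lact_lact)
qed

lemma semiring_of_carrier [simp]:
  "carrier (semiring_of M) = carrier M" "add (semiring_of M) = add M"
  "mult (semiring_of M) = amult M" "zero (semiring_of M) = \<zero>" "one (semiring_of M) = unit_T M"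
  by (simp_all add: semiring_of_def)

lemma semiring_semiring_of: "semiring (semiring_of M)"
proof (intro semiring.intro abelian_monoidI monoidI semiring_axioms.intro; simp)
  fix x y z
  assume x: "x \<in> carrier M" and y: "y \<in> carrier M"
  show "x \<oplus> y = y \<oplus> x" using x y by (rule a_comm)
  show "amult M x y \<in> carrier M" using x y by (rule amult_closed)
  assume z: "z \<in> carrier M"
  show "x \<oplus> y \<oplus> z = x \<oplus> (y \<oplus> z)" using x y z by (rule a_assoc)
  show "amult M (x \<oplus> y) z = amult M x z \<oplus> amult M y z" using x y z by (rule amult_add_left)
  show "amult M (amult M x y) z = amult M x (amult M y z)"
    using x
  proof (induction rule: carrier_induct)
    case zero
    then show ?case using y z by (simp add: amult_zero_left amult_closed)
  next
    case (add a x)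
    then show ?case
      using y z by (simp add: amult_add_left(1) amult_closed tangible_closed amult_tangible_left
          lact_closed amult_tangible_assoc)
  qed
  show "amult M z (x \<oplus> y) = amult M z x \<oplus> amult M z y"
    using z
  proof (induction rule: carrier_induct)
    case zero
    then show ?case using x y by (simp add: amult_zero_left)
  next
    case (add a z)
    then show ?case
      using x y by (simp add: amult_add_left(1) amult_closed tangible_closed amult_tangible_left
          lact_closed lact_add a_ac)
  qed
next
  show "unit_T M \<in> carrier M" using unit_T_closed by (rule tangible_closed)
next
  fix x assume x: "x \<in> carrier M"
  show "amult M (unit_T M) x = x"
    using x by (simp add: amult_tangible_left unit_T_closed lact_unit)
  show "amult M x (unit_T M) = x"
    using x by (simp add: amult_tangible_right unit_T_closed ract_unit)
  show "amult M \<zero> x = \<zero>" using x by (rule amult_zero_left)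
  show "amult M x \<zero> = \<zero>"
    using x
  proof (induction rule: carrier_induct)
    case zero
    then show ?case by (simp add: amult_zero_left)
  next
    case (add a x)
    then show ?case
      by (simp add: amult_add_left(1) tangible_closed amult_tangible_left lact_zero)
  qed
qed

end

lemma semiring_restrict:
  fixes R :: "'a ring"
  assumes "semiring R" "S \<subseteq> carrier R" "\<zero>\<^bsub>R\<^esub> \<in> S" "u \<in> S"
    and "\<And>x y. \<lbrakk>x \<in> S; y \<in> S\<rbrakk> \<Longrightarrow> x \<oplus>\<^bsub>R\<^esub> y \<in> S"
    and "\<And>x y. \<lbrakk>x \<in> S; y \<in> S\<rbrakk> \<Longrightarrow> x \<otimes>\<^bsub>R\<^esub> y \<in> S"
    and "\<And>x. x \<in> S \<Longrightarrow> u \<otimes>\<^bsub>R\<^esub> x = x" "\<And>x. x \<in> S \<Longrightarrow> x \<otimes>\<^bsub>R\<^esub> u = x"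
  shows "semiring (restrict_semiring R S u)"
proof -
  interpret semiring R by fact
  have S: "\<And>x. x \<in> S \<Longrightarrow> x \<in> carrier R" using assms(2) by blast
  show ?thesis
    by (intro semiring.intro abelian_monoidI monoidI semiring_axioms.intro)
      (auto simp: assms S a_ac m_assoc l_distr r_distr)
qed

section \<open>Circle values\<close>

sublocale metatangible_mon_pair \<subseteq> admissible_mon_pair ..

context metatangible_mon_pair
begin

abbreviation circle :: "'a \<Rightarrow> 'a"  (\<open>_\<degree>\<close> [1000] 999)
  where "x\<degree> \<equiv> circ M d x"

abbreviation unit_circle :: 'a  (\<open>\<e>\<close>)
  where "\<e> \<equiv> (unit_T M)\<degree>"

lemma circ_closed: "x \<in> carrier M \<Longrightarrow> x\<degree> \<in> carrier M"
  by (simp add: circ_def ract_closed dag_tangible)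

lemma circ_zero [simp]: "\<zero>\<degree> = \<zero>"
  by (simp add: circ_def ract_zero dag_tangible)

lemma circ_add: "\<lbrakk>x \<in> carrier M; y \<in> carrier M\<rbrakk> \<Longrightarrow> (x \<oplus> y)\<degree> = x\<degree> \<oplus> y\<degree>"
  by (simp add: circ_def ract_closed ract_add dag_tangible a_ac)

lemma circ_lact: "\<lbrakk>t \<in> Tan M; x \<in> carrier M\<rbrakk> \<Longrightarrow> (t \<triangleright> x)\<degree> = t \<triangleright> x\<degree>"
  by (simp add: circ_def lact_add act_compat ract_closed dag_tangible)

lemma circ_ract:
  assumes "t \<in> Tan M" "x \<in> carrier M"
  shows "(x \<triangleleft> t)\<degree> = x\<degree> \<triangleleft> t"
proof -
  have "(x \<triangleleft> t) \<triangleleft> d = (x \<triangleleft> d) \<triangleleft> t"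
    using assms act_compat[of d t x] dag_central[of x] dag_central[of "x \<triangleleft> t"]
    by (simp add: dag_tangible ract_closed)
  then show ?thesis
    using assms by (simp add: circ_def ract_add ract_closed dag_tangible)
qed

lemma unit_circle_closed: "\<e> \<in> carrier M"
  by (simp add: circ_closed tangible_closed unit_T_closed)

lemma circ_tangible: "a \<in> Tan M \<Longrightarrow> a\<degree> = a \<triangleright> \<e>"
  using circ_lact[of a "unit_T M"] by (simp add: tangible_closed unit_T_closed lact_on_unit)

lemma circ_mem_A0:
  assumes "x \<in> carrier M"
  shows "x\<degree> \<in> A0"
  using assms
proof (induction rule: carrier_induct)
  case zero
  then show ?case by (simp add: A0_zero)
next
  case (add a x)
  have "\<e> \<in> A0"
    using unit_add_dag by (simp add: circ_def ract_on_unit dag_tangible)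
  then show ?case
    using add by (simp add: circ_add tangible_closed A0_add A0_lact circ_tangible[of a])
qed

lemma tangible_notin_A0: "a \<in> Tan M \<Longrightarrow> a \<notin> A0"
  using A0_Int_Tan0 zero_not_tangible by (metis IntI insertI2 singletonD)

lemma circ_not_tangible: "x \<in> carrier M \<Longrightarrow> x\<degree> \<notin> Tan M"
  using circ_mem_A0 tangible_notin_A0 by blast

text \<open>Property N applies to \<open>1 + 1\<^sup>\<dagger>\<close> and to \<open>1\<^sup>\<dagger> + 1\<close> alike, so both equal \<open>1\<degree>\<close> and \<open>(1\<^sup>\<dagger>)\<degree>\<close>.\<close>

lemma circ_dag:
  assumes "a \<in> Tan M"
  shows "(a \<triangleleft> d)\<degree> = a\<degree>"
proof -
  have eq: "d \<oplus> unit_T M = unit_T M \<oplus> d"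
    by (simp add: a_comm tangible_closed dag_tangible unit_T_closed)
  have "d\<degree> = \<e>"
    using add_eq_circ[of d "unit_T M"] add_eq_circ[of "unit_T M" d] unit_add_dag eq
    by (simp add: dag_tangible unit_T_closed)
  then show ?thesis
    using assms circ_lact[of a d]
    by (simp add: ract_eq_lact dag_tangible tangible_closed circ_tangible)
qed

lemma circ_circ_tangible: "a \<in> Tan M \<Longrightarrow> (a\<degree>)\<degree> = a\<degree> \<oplus> a\<degree>"
  using circ_add[of a "a \<triangleleft> d"] circ_dag[of a]
  by (simp add: circ_def[of M d a] tangible_closed ract_closed dag_tangible)

lemma circ_eq_of_add_mem_A0:
  assumes "a \<in> Tan M" "b \<in> Tan M" "a \<oplus> b \<in> A0"
  shows "a \<oplus> b = a\<degree>" "a\<degree> = b\<degree>"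
  using assms add_eq_circ[of a b] add_eq_circ[of b a] by (auto simp: a_comm tangible_closed)

lemma circ_lact_cancel:
  assumes "t \<in> Tan M" "a \<in> carrier M" "b \<in> carrier M"
  shows "(t \<triangleright> a)\<degree> = (t \<triangleright> b)\<degree> \<longleftrightarrow> a\<degree> = b\<degree>"
  using assms lact_cancel[of t "a\<degree>" "b\<degree>"] by (auto simp: circ_lact circ_closed)

lemma lact_eq_zero: "\<lbrakk>a \<in> Tan M; x \<in> carrier M; a \<triangleright> x = \<zero>\<rbrakk> \<Longrightarrow> x = \<zero>"
  using lact_cancel[of a x \<zero>] by (simp add: lact_zero)

lemma circ_tangible_eq_zero: "a \<in> Tan M \<Longrightarrow> a\<degree> = \<zero> \<Longrightarrow> \<e> = \<zero>"
  using lact_eq_zero[of a \<e>] by (simp add: circ_tangible unit_circle_closed)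

lemma Tan0_closed: "a \<in> Tan0 M \<Longrightarrow> a \<in> carrier M"
  using tangible_closed by auto

lemma Tan0_monoid_simps [simp]:
  "carrier (Tan0_monoid M) = Tan0 M" "one (Tan0_monoid M) = unit_T M"
  "\<zero> \<otimes>\<^bsub>Tan0_monoid M\<^esub> a = \<zero>" "a \<otimes>\<^bsub>Tan0_monoid M\<^esub> \<zero> = \<zero>"
  by (simp_all add: Tan0_monoid_def)

lemma Tan0_mult_tangible:
  assumes "a \<in> Tan M" "b \<in> Tan M"
  shows "a \<otimes>\<^bsub>Tan0_monoid M\<^esub> b = a \<triangleright> b"
  using assms zero_not_tangible by (auto simp: Tan0_monoid_def tangible_mult)

lemma Tan0_mult_left:
  assumes "a \<in> Tan M" "b \<in> Tan0 M"
  shows "a \<otimes>\<^bsub>Tan0_monoid M\<^esub> b = a \<triangleright> b"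
  using assms by (auto simp: Tan0_mult_tangible lact_zero)

lemma Tan0_mult_closed: "\<lbrakk>a \<in> Tan0 M; b \<in> Tan0 M\<rbrakk> \<Longrightarrow> a \<otimes>\<^bsub>Tan0_monoid M\<^esub> b \<in> Tan0 M"
  by (auto simp: Tan0_mult_tangible tangible_lact_closed)

lemma monoid_Tan0: "monoid (Tan0_monoid M)"
proof (rule monoidI)
  fix x y z
  assume "x \<in> carrier (Tan0_monoid M)" "y \<in> carrier (Tan0_monoid M)" "z \<in> carrier (Tan0_monoid M)"
  then show "x \<otimes>\<^bsub>Tan0_monoid M\<^esub> y \<otimes>\<^bsub>Tan0_monoid M\<^esub> z = x \<otimes>\<^bsub>Tan0_monoid M\<^esub> (y \<otimes>\<^bsub>Tan0_monoid M\<^esub> z)"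
    by (auto simp: Tan0_mult_tangible tangible_lact_closed lact_lact tangible_closed)
next
  fix x
  assume "x \<in> carrier (Tan0_monoid M)"
  then show "\<one>\<^bsub>Tan0_monoid M\<^esub> \<otimes>\<^bsub>Tan0_monoid M\<^esub> x = x" "x \<otimes>\<^bsub>Tan0_monoid M\<^esub> \<one>\<^bsub>Tan0_monoid M\<^esub> = x"
    by (auto simp: Tan0_mult_tangible unit_T_closed lact_unit lact_on_unit tangible_closed)
qed (use Tan0_mult_closed unit_T_closed in auto)

text \<open>For tangible factors \<open>(a b)\<degree> = a b\<degree> = a\<degree> b\<close>, so either factor may be replaced by one with the
  same image. A zero factor can share its image with a tangible one only when \<open>1\<degree> = 0\<close>, and then the
  map vanishes.\<close>

lemma circ_mult_cong:
  assumes "a1 \<in> Tan0 M" "a2 \<in> Tan0 M" "b1 \<in> Tan0 M" "b2 \<in> Tan0 M"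
    and "a1\<degree> = b1\<degree>" "a2\<degree> = b2\<degree>"
  shows "(a1 \<otimes>\<^bsub>Tan0_monoid M\<^esub> a2)\<degree> = (b1 \<otimes>\<^bsub>Tan0_monoid M\<^esub> b2)\<degree>"
proof (cases "\<e> = \<zero>")
  case True
  have "a\<degree> = \<zero>" if "a \<in> Tan0 M" for a
    using that True by (auto simp: circ_tangible lact_zero)
  then show ?thesis
    using assms Tan0_mult_closed by presburger
next
  case False
  then have zero: "a1 = \<zero> \<longleftrightarrow> b1 = \<zero>" "a2 = \<zero> \<longleftrightarrow> b2 = \<zero>"
    using assms circ_tangible_eq_zero by (metis circ_zero insert_iff)+
  show ?thesis
  proof (cases "a1 = \<zero> \<or> a2 = \<zero>")
    case True
    with zero show ?thesis by auto
  next
    case False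
    with zero assms have T: "a1 \<in> Tan M" "a2 \<in> Tan M" "b1 \<in> Tan M" "b2 \<in> Tan M"
      by auto
    have "(a1 \<triangleright> a2)\<degree> = (a1 \<triangleright> b2)\<degree>"
      using assms T by (simp add: circ_lact tangible_closed)
    also have "\<dots> = (a1 \<triangleleft> b2)\<degree>"
      using T by (simp add: ract_eq_lact)
    also have "\<dots> = (b1 \<triangleleft> b2)\<degree>"
      using assms T by (simp add: circ_ract tangible_closed)
    finally show ?thesis
      using T by (simp add: Tan0_mult_tangible ract_eq_lact)
  qed
qed

lemma odot_circ:
  assumes "a \<in> Tan0 M" "b \<in> Tan0 M"
  shows "odot M d (a\<degree>) (b\<degree>) = (a \<otimes>\<^bsub>Tan0_monoid M\<^esub> b)\<degree>"
  unfolding odot_def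
proof (rule the_equality)
  show "\<exists>a1\<in>Tan0 M. \<exists>a2\<in>Tan0 M. a\<degree> = a1\<degree> \<and> b\<degree> = a2\<degree> \<and>
      (a \<otimes>\<^bsub>Tan0_monoid M\<^esub> b)\<degree> = (a1 \<otimes>\<^bsub>Tan0_monoid M\<^esub> a2)\<degree>"
    using assms by blast
next
  fix z
  assume "\<exists>a1\<in>Tan0 M. \<exists>a2\<in>Tan0 M. a\<degree> = a1\<degree> \<and> b\<degree> = a2\<degree> \<and> z = (a1 \<otimes>\<^bsub>Tan0_monoid M\<^esub> a2)\<degree>"
  then show "z = (a \<otimes>\<^bsub>Tan0_monoid M\<^esub> b)\<degree>"
    using circ_mult_cong assms by metis
qed

lemma Todot_monoid_simps [simp]:
  "carrier (Todot_monoid M d) = circle ` Tan0 M" "mult (Todot_monoid M d) = odot M d"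
  "one (Todot_monoid M d) = \<e>"
  by (simp_all add: Todot_monoid_def)

lemma monoid_Todot: "monoid (Todot_monoid M d)"
proof -
  interpret T0: monoid "Tan0_monoid M" by (rule monoid_Tan0)
  have one: "unit_T M \<in> Tan0 M" by (simp add: unit_T_closed)
  show ?thesis
  proof (rule monoidI, unfold Todot_monoid_simps)
    fix x y assume "x \<in> circle ` Tan0 M" "y \<in> circle ` Tan0 M"
    then show "odot M d x y \<in> circle ` Tan0 M"
      by (elim imageE) (simp only: odot_circ Tan0_mult_closed imageI)
    fix z assume "z \<in> circle ` Tan0 M"
    with \<open>x \<in> _\<close> \<open>y \<in> _\<close> show "odot M d (odot M d x y) z = odot M d x (odot M d y z)"
      by (elim imageE)
        (simp only: odot_circ Tan0_mult_closed T0.m_assoc Tan0_monoid_simps)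
  next
    show "\<e> \<in> circle ` Tan0 M" using one by (rule imageI)
  next
    fix x assume "x \<in> circle ` Tan0 M"
    then show "odot M d \<e> x = x" "odot M d x \<e> = x"
      using T0.l_one T0.r_one one by (elim imageE; simp only: odot_circ Tan0_monoid_simps)+
  qed
qed

lemma circ_hom: "circle \<in> hom (Tan0_monoid M) (Todot_monoid M d)"
  by (rule homI, unfold Tan0_monoid_simps Todot_monoid_simps)
    (simp_all only: odot_circ imageI)

end

section \<open>Homogeneous sums in a bipotent pair\<close>

locale bipotent_mon_pair = metatangible_mon_pair M A0 d
  for M :: "('a, 'a, 'm) tbimod_scheme" (structure) and A0 :: "'a set" and d :: 'a +
  assumes bipotent: "\<lbrakk>a \<in> Tan M; b \<in> Tan M\<rbrakk> \<Longrightarrow> a \<oplus> b \<in> {a, b} \<union> A0"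
begin

lemma add_of_circ_neq:
  assumes "a \<in> Tan M" "b \<in> Tan M" "a\<degree> \<noteq> b\<degree>"
  shows "a \<oplus> b = a \<or> b \<oplus> a = b"
  using assms bipotent[of a b] circ_eq_of_add_mem_A0[of a b]
  by (auto simp: a_comm tangible_closed)

lemma add_of_circ_eq:
  assumes "a \<in> Tan M" "b \<in> Tan M" "a\<degree> = b\<degree>"
  shows "a \<oplus> b \<in> {a, b, a\<degree>}"
  using assms bipotent[of a b] circ_eq_of_add_mem_A0[of a b] by auto

text \<open>Otherwise \<open>b'\<close> would absorb \<open>a'\<close>, so that \<open>b\<degree>\<close> and \<open>a\<degree>\<close> would absorb each other.\<close>

lemma absorb_transfer:
  assumes "a \<in> Tan M" "b \<in> Tan M" "a' \<in> Tan M" "b' \<in> Tan M"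
    and "a\<degree> \<noteq> b\<degree>" "a \<oplus> b = a" "a'\<degree> = a\<degree>" "b'\<degree> = b\<degree>"
  shows "a' \<oplus> b' = a'"
proof (rule ccontr)
  assume "a' \<oplus> b' \<noteq> a'"
  then have "b' \<oplus> a' = b'"
    using add_of_circ_neq[of a' b'] assms by auto
  then have "b\<degree> \<oplus> a\<degree> = b\<degree>"
    using circ_add[of b' a'] assms by (simp add: tangible_closed)
  moreover have "a\<degree> \<oplus> b\<degree> = a\<degree>"
    using circ_add[of a b] assms by (simp add: tangible_closed)
  ultimately show False
    using assms by (simp add: a_comm circ_closed tangible_closed)
qed

text \<open>Only the circle value of \<open>a\<close> enters. Allowing different summands, rather than multiples of a
  single element, makes one notion serve both kinds: it covers \<open>k a\<close> as well as \<open>a\<degree>\<close>, whose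
  summands \<open>a\<close> and \<open>a 1\<^sup>\<dagger>\<close> have the same circle value.\<close>

inductive homogeneous :: "'a \<Rightarrow> 'a \<Rightarrow> bool" for a where
  single: "\<lbrakk>x \<in> Tan M; x\<degree> = a\<degree>\<rbrakk> \<Longrightarrow> homogeneous a x"
| add: "\<lbrakk>x \<in> Tan M; x\<degree> = a\<degree>; homogeneous a c\<rbrakk> \<Longrightarrow> homogeneous a (x \<oplus> c)"

lemma homogeneous_closed: "homogeneous a c \<Longrightarrow> c \<in> carrier M"
  by (induction rule: homogeneous.induct) (auto simp: tangible_closed)

lemma homogeneous_self: "a \<in> Tan M \<Longrightarrow> homogeneous a a"
  by (simp add: homogeneous.single)

lemma homogeneous_cong: "homogeneous a c \<Longrightarrow> a\<degree> = b\<degree> \<Longrightarrow> homogeneous b c"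
  by (induction rule: homogeneous.induct) (auto intro: homogeneous.intros)

lemma homogeneous_add:
  "homogeneous a c \<Longrightarrow> homogeneous a c' \<Longrightarrow> homogeneous a (c \<oplus> c')"
  by (induction rule: homogeneous.induct)
    (auto intro: homogeneous.intros simp: a_assoc tangible_closed homogeneous_closed)

lemma homogeneous_lact:
  assumes "t \<in> Tan M" "a \<in> Tan M"
  shows "homogeneous a c \<Longrightarrow> homogeneous (t \<triangleright> a) (t \<triangleright> c)"
proof (induction rule: homogeneous.induct)
  case (single x)
  then show ?case
    using assms by (auto intro!: homogeneous.single simp: tangible_lact_closed circ_lact_cancel tangible_closed)
next
  case (add x c)
  then show ?case
    using assms
    by (auto intro!: homogeneous.add
        simp: tangible_lact_closed circ_lact_cancel tangible_closed lact_add homogeneous_closed)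
qed

lemma homogeneous_add_pow:
  fixes k :: nat
  assumes "a \<in> Tan M" "k \<ge> 1"
  shows "homogeneous a ([k] \<cdot> a)"
  using assms(2)
  by (induction k rule: dec_induct)
    (use assms(1) in \<open>auto intro: homogeneous_self homogeneous_add simp: tangible_closed\<close>)

lemma circ_homogeneous:
  assumes "homogeneous a c" "a \<in> Tan M"
  shows "\<exists>n::nat. n \<ge> 1 \<and> c\<degree> = [n] \<cdot> a\<degree>"
  using assms(1)
proof (induction rule: homogeneous.induct)
  case (single x)
  then show ?case
    using assms(2) by (intro exI[of _ 1]) (simp add: circ_closed tangible_closed)
next
  case (add x c)
  then obtain n :: nat where "n \<ge> 1" "c\<degree> = [n] \<cdot> a\<degree>" by blast
  with add show ?case
    using assms(2)
    by (intro exI[of _ "Suc n"])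
      (simp add: circ_add circ_closed tangible_closed homogeneous_closed a_comm)
qed

text \<open>Absorption depends on circle values only, so every summand of \<open>c\<close> absorbs every summand of
  \<open>c'\<close>.\<close>

lemma homogeneous_absorb:
  assumes "a \<in> Tan M" "b \<in> Tan M" "a\<degree> \<noteq> b\<degree>" "a \<oplus> b = a"
    and "homogeneous a c" "homogeneous b c'"
  shows "c \<oplus> c' = c"
proof -
  have single: "x \<oplus> c' = x" if "x \<in> Tan M" "x\<degree> = a\<degree>" for x
    using assms(6)
  proof (induction rule: homogeneous.induct)
    case (single y)
    then show ?case using absorb_transfer[of a b x y] assms that by simp
  next
    case (add y c')
    then show ?case
      using absorb_transfer[of a b x y] assms that a_assoc[of x y c']
      by (simp add: tangible_closed homogeneous_closed)
  qed
  from assms(5) show ?thesis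
    by (induction rule: homogeneous.induct)
      (use single assms(6) in \<open>auto simp: a_assoc tangible_closed homogeneous_closed\<close>)
qed

text \<open>Adding a tangible element either extends a homogeneous sum, is absorbed by it, or absorbs it.\<close>

lemma homogeneous_exists:
  assumes "c \<in> carrier M"
  shows "c = \<zero> \<or> (\<exists>a\<in>Tan M. homogeneous a c)"
  using assms
proof (induction rule: carrier_induct)
  case (add x c)
  show ?case
  proof (cases "c = \<zero>")
    case True
    then show ?thesis using add by (auto simp: tangible_closed intro: homogeneous_self)
  next
    case False
    then obtain a where a: "a \<in> Tan M" "homogeneous a c" using add by blast
    consider "x\<degree> = a\<degree>" | "x\<degree> \<noteq> a\<degree>" "x \<oplus> a = x" | "x\<degree> \<noteq> a\<degree>" "a \<oplus> x = a"
      using add_of_circ_neq[of x a] add a by auto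
    then show ?thesis
    proof cases
      case 1
      then show ?thesis using a add by (auto intro: homogeneous.add)
    next
      case 2
      then have "x \<oplus> c = x"
        using homogeneous_absorb[of x a x c] a add by (simp add: homogeneous_self)
      then show ?thesis using add by (auto intro: homogeneous_self)
    next
      case 3
      then have "c \<oplus> x = c"
        using homogeneous_absorb[of a x c x] a add by (simp add: homogeneous_self)
      then show ?thesis using a add by (auto simp: a_comm tangible_closed)
    qed
  qed
qed simp


section \<open>The two kinds\<close>

lemma add_self: "a \<in> Tan M \<Longrightarrow> a \<oplus> a = a \<triangleright> (unit_T M \<oplus> unit_T M)"
  by (simp add: lact_add lact_on_unit tangible_closed unit_T_closed)

lemma second_kind_iff: "second_kind M A0 \<longleftrightarrow> \<not> first_kind M A0"
proof
  assume "second_kind M A0"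
  then show "\<not> first_kind M A0"
    using unit_T_closed unfolding second_kind_def first_kind_def by blast
next
  assume not: "\<not> first_kind M A0"
  have "a \<oplus> a \<notin> A0" if "a \<in> Tan M" for a
    using not that lact_reflect[of a "unit_T M \<oplus> unit_T M"]
    unfolding first_kind_def add_self[OF that] by (auto simp: tangible_closed unit_T_closed)
  then show "second_kind M A0" by (simp add: second_kind_def)
qed

lemma first_kind_circ_tangible:
  assumes "first_kind M A0" "a \<in> Tan M"
  shows "a\<degree> = a \<oplus> a"
proof -
  have "a \<oplus> a \<in> A0"
    using assms A0_lact[of a] by (simp add: add_self[OF assms(2)] first_kind_def)
  then show ?thesis using circ_eq_of_add_mem_A0 assms by auto
qed

lemma first_kind_circ:
  assumes "first_kind M A0" "c \<in> carrier M"
  shows "c\<degree> = c \<oplus> c"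
  using assms(2)
  by (induction rule: carrier_induct)
    (auto simp: circ_add tangible_closed first_kind_circ_tangible[OF assms(1)] a_ac)

lemma second_kind_idem:
  assumes "second_kind M A0" "c \<in> carrier M"
  shows "c \<oplus> c = c"
  using assms(2)
proof (induction rule: carrier_induct)
  case (add a c)
  have "a \<oplus> a = a"
    using bipotent[of a a] assms(1) add by (auto simp: second_kind_def)
  then have "(a \<oplus> a) \<oplus> (c \<oplus> c) = a \<oplus> c" using add by simp
  then show ?case using add by (simp add: a_ac tangible_closed)
qed simp

text \<open>Tangible elements are idempotent here, so a sum of two tangible elements with circle value
  \<open>a\<degree>\<close> is one of them or \<open>a\<degree>\<close>, and \<open>a\<degree>\<close> absorbs them.\<close>

lemma second_kind_homogeneous:
  assumes "second_kind M A0" "a \<in> Tan M" "homogeneous a c"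
  shows "(c \<in> Tan M \<and> c\<degree> = a\<degree>) \<or> c = a\<degree>"
  using assms(3)
proof (induction rule: homogeneous.induct)
  case (add x c)
  have "x \<oplus> x\<degree> = x\<degree>"
    using add a_assoc[of x x "x \<triangleleft> d"]
    by (simp add: circ_def tangible_closed ract_closed dag_tangible second_kind_idem[OF assms(1)])
  with add show ?case
    using add_of_circ_eq[of x c] assms(2) by auto
qed simp

text \<open>If \<open>1\<degree> = 0\<close>, then \<open>1 = 1 + (1 + 1\<^sup>\<dagger>) = 1 + 1\<^sup>\<dagger> = 0\<close>.\<close>

lemma second_kind_unit_circle_nonzero:
  assumes "second_kind M A0"
  shows "\<e> \<noteq> \<zero>"
proof
  assume e: "\<e> = \<zero>"
  have "unit_T M \<oplus> \<e> = \<e>"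
    using a_assoc[of "unit_T M" "unit_T M" d]
    by (simp add: circ_def ract_on_unit dag_tangible tangible_closed unit_T_closed
        second_kind_idem[OF assms])
  then have "unit_T M = \<zero>"
    using e by (simp add: tangible_closed unit_T_closed)
  then show False using unit_T_closed zero_not_tangible by simp
qed

text \<open>In the first kind \<open>1\<degree>\<close> is \<open>2 \<cdot> 1\<close>; in the second it is idempotent and nonzero.\<close>

lemma unit_circle_multiples_nonzero:
  fixes n :: nat
  assumes "first_kind M A0 \<Longrightarrow> unit_multiples_nonzero M" "n \<ge> 1"
  shows "[n] \<cdot> \<e> \<noteq> \<zero>"
proof (cases "first_kind M A0")
  case True
  have "\<e> = [(2::nat)] \<cdot> unit_T M"
    using first_kind_circ_tangible[OF True unit_T_closed]
    by (simp add: numeral_2_eq_2 tangible_closed unit_T_closed)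
  then have "[n] \<cdot> \<e> = [(2 * n)] \<cdot> unit_T M"
    by (simp add: add.nat_pow_pow tangible_closed unit_T_closed)
  then show ?thesis
    using assms True by (simp add: unit_multiples_nonzero_def)
next
  case False
  then have "second_kind M A0" by (simp add: second_kind_iff)
  then show ?thesis
    using add_pow_idem[OF unit_circle_closed] second_kind_idem[OF _ unit_circle_closed]
      second_kind_unit_circle_nonzero assms(2) by metis
qed

lemma homogeneous_nonzero:
  assumes "\<And>n::nat. n \<ge> 1 \<Longrightarrow> [n] \<cdot> \<e> \<noteq> \<zero>"
    and "a \<in> Tan M" "homogeneous a c"
  shows "c \<noteq> \<zero>"
proof
  assume "c = \<zero>"
  obtain n :: nat where n: "n \<ge> 1" "c\<degree> = [n] \<cdot> a\<degree>"
    using circ_homogeneous assms by blast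
  have "a \<triangleright> ([n] \<cdot> \<e>) = \<zero>"
    using n \<open>c = \<zero>\<close> assms(2) by (simp add: lact_add_pow circ_tangible unit_circle_closed)
  then show False
    using lact_eq_zero[of a "[n] \<cdot> \<e>"] assms n(1) by (simp add: unit_circle_closed)
qed

text \<open>Suppose \<open>c\<close> is homogeneous both for \<open>a\<close> and for \<open>b\<close>, where \<open>a\<close> absorbs \<open>b\<close>. Then \<open>c\<close> is
  absorbed by \<open>a\<close>, absorbs \<open>b\<close> and is idempotent. In the first kind \<open>c = c\<degree>\<close> is both \<open>a L\<close> and
  \<open>b K\<close> with \<open>L\<close> and \<open>K\<close> multiples of \<open>1\<degree>\<close>; cancelling \<open>a\<close> and \<open>b\<close> shows that \<open>L\<close> and \<open>K\<close> are
  idempotent, hence equal, and that \<open>1 = 1 + L = K\<close>. Thus \<open>1 + 1 = 1\<close>, although \<open>1 + 1\<close> lies in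
  \<open>A0\<close> and \<open>1\<close> does not. In the second kind \<open>c\<close> is either tangible or equal to both \<open>a\<degree>\<close> and
  \<open>b\<degree>\<close>, and in either case its circle value is shared by \<open>a\<close> and \<open>b\<close>.\<close>

lemma homogeneous_unique_aux:
  assumes "a \<in> Tan M" "b \<in> Tan M" "a\<degree> \<noteq> b\<degree>" "a \<oplus> b = a"
    and "homogeneous a c" "homogeneous b c"
  shows False
proof (cases "first_kind M A0")
  case True
  let ?u = "unit_T M"
  have u: "?u \<in> carrier M" by (simp add: tangible_closed unit_T_closed)
  have c: "c \<in> carrier M" using assms homogeneous_closed by blast
  have cc: "c \<oplus> c = c" using homogeneous_absorb assms by blast
  have ac: "a \<oplus> c = a" using homogeneous_absorb[of a b a c] assms homogeneous_self by blast
  have bc: "b \<oplus> c = c"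
    using homogeneous_absorb[of a b c b] assms homogeneous_self c by (simp add: a_comm tangible_closed)
  have c_circ: "c\<degree> = c" using first_kind_circ[OF True c] cc by simp
  obtain n m :: nat where nm: "n \<ge> 1" "c = [n] \<cdot> a\<degree>" "m \<ge> 1" "c = [m] \<cdot> b\<degree>"
    using circ_homogeneous[OF assms(5,1)] circ_homogeneous[OF assms(6,2)] c_circ by auto
  define L where "L = [n] \<cdot> \<e>"
  define K where "K = [m] \<cdot> \<e>"
  have LK: "L \<in> carrier M" "K \<in> carrier M"
    by (simp_all add: L_def K_def unit_circle_closed)
  have cL: "c = a \<triangleright> L" and cK: "c = b \<triangleright> K"
    using nm assms by (simp_all add: L_def K_def lact_add_pow circ_tangible unit_circle_closed)
  have LL: "L \<oplus> L = L"
    using cc lact_cancel[of a "L \<oplus> L" L] assms LK by (simp add: cL lact_add)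
  have KK: "K \<oplus> K = K"
    using cc lact_cancel[of b "K \<oplus> K" K] assms LK by (simp add: cK lact_add)
  have uL: "?u \<oplus> L = ?u"
    using ac lact_cancel[of a "?u \<oplus> L" ?u] assms LK u by (simp add: cL lact_add lact_on_unit)
  have uK: "?u \<oplus> K = K"
    using bc lact_cancel[of b "?u \<oplus> K" K] assms LK u by (simp add: cK lact_add lact_on_unit)
  have "K = [n] \<cdot> K" using add_pow_idem[OF LK(2) KK nm(1)] by simp
  also have "\<dots> = [m] \<cdot> L"
    by (simp add: L_def K_def add.nat_pow_pow unit_circle_closed mult.commute)
  also have "\<dots> = L" using add_pow_idem[OF LK(1) LL nm(3)] .
  finally have "?u \<oplus> ?u = ?u" using uL uK KK by simp
  then show False
    using True tangible_notin_A0[OF unit_T_closed] by (simp add: first_kind_def)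
next
  case False
  then have "second_kind M A0" by (simp add: second_kind_iff)
  then show False
    using second_kind_homogeneous[of a c] second_kind_homogeneous[of b c] assms
      circ_not_tangible tangible_closed by metis
qed

lemma homogeneous_unique:
  assumes "a \<in> Tan M" "b \<in> Tan M" "homogeneous a c" "homogeneous b c"
  shows "a\<degree> = b\<degree>"
  using assms add_of_circ_neq[of a b] homogeneous_unique_aux[of a b c]
    homogeneous_unique_aux[of b a c] by metis


section \<open>Uniform presentations\<close>

lemma homogeneous_of_uniform_rep:
  assumes "uniform_rep M A0 d c a" "c \<noteq> \<zero>"
  shows "homogeneous a c"
proof -
  have a: "a \<in> Tan M" using assms by (simp add: uniform_rep_def)
  show ?thesis
  proof (cases "first_kind M A0")
    case True
    then have c: "c = [height M c] \<cdot> a" using assms by (simp add: uniform_rep_def)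
    then have "height M c \<ge> 1"
      using assms(2) by (metis add.nat_pow_0 less_one linorder_not_less)
    then show ?thesis using homogeneous_add_pow[OF a] c by metis
  next
    case False
    then have "c = a \<or> c = a\<degree>" using assms by (simp add: uniform_rep_def second_kind_iff)
    moreover have "homogeneous a (a \<triangleleft> d)"
      using a circ_dag[OF a]
      by (intro homogeneous.single) (simp_all add: ract_eq_lact tangible_lact_closed dag_tangible)
    ultimately show ?thesis
      using a homogeneous_add[OF homogeneous_self[OF a]] homogeneous_self[OF a]
      by (auto simp: circ_def)
  qed
qed

lemma lsum_eq_multiple:
  assumes "x \<in> carrier M" "set ys \<subseteq> carrier M" "\<And>y. y \<in> set ys \<Longrightarrow> x \<oplus> y = x \<oplus> x"
  shows "x \<oplus> lsum M ys = [Suc (length ys)] \<cdot> x"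
  using assms(2,3)
proof (induction ys)
  case (Cons y ys)
  have "x \<oplus> (y \<oplus> lsum M ys) = x \<oplus> (x \<oplus> lsum M ys)"
    using Cons.prems assms(1) by (simp add: a_assoc[symmetric] lsum_closed)
  then show ?case using Cons assms(1) by (simp add: a_comm)
qed (simp add: assms(1))

text \<open>For the first kind, take a presentation \<open>x + \<Sum> ys\<close> with as few summands as possible. Then no
  \<open>x + y\<close> with \<open>y\<close> in \<open>ys\<close> is tangible, since otherwise the two summands could be merged; hence
  \<open>x + y = x\<degree> = x + x\<close>, and all summands may be replaced by \<open>x\<close>.\<close>

lemma uniform_rep_exists:
  assumes c: "c \<in> carrier M" "c \<noteq> \<zero>"
  shows "\<exists>a. uniform_rep M A0 d c a"
proof (cases "first_kind M A0")
  case True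
  let ?P = "\<lambda>n. \<exists>xs. length xs = n \<and> set xs \<subseteq> Tan M \<and> lsum M xs = c"
  have "\<exists>n. ?P n" using obtain_tangible_list[OF c(1)] by metis
  then have "?P (height M c)" unfolding height_def by (rule LeastI_ex)
  then obtain xs where xs: "length xs = height M c" "set xs \<subseteq> Tan M" "lsum M xs = c" by blast
  with c obtain x ys where xs_eq: "xs = x # ys" by (cases xs) auto
  have x: "x \<in> Tan M" and ys: "set ys \<subseteq> Tan M" using xs xs_eq by auto
  then have x': "x \<in> carrier M" and ys': "set ys \<subseteq> carrier M"
    using tangible_subset by auto
  have "x \<oplus> y = x \<oplus> x" if y: "y \<in> set ys" for y
  proof -
    have "x \<oplus> y \<notin> Tan M"
    proof
      assume xy: "x \<oplus> y \<in> Tan M"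
      have rem: "set (remove1 y ys) \<subseteq> carrier M" "set (remove1 y ys) \<subseteq> Tan M"
        using set_remove1_subset[of y ys] ys ys' by blast+
      have "lsum M ((x \<oplus> y) # remove1 y ys) = c"
        using lsum_remove1[OF ys' y] rem x' y ys' xs
        by (simp add: xs_eq a_assoc lsum_closed subset_iff)
      then have "?P (length ((x \<oplus> y) # remove1 y ys))"
        using xy rem by (intro exI[of _ "(x \<oplus> y) # remove1 y ys"]) simp
      moreover have "length ((x \<oplus> y) # remove1 y ys) < height M c"
        using y length_pos_if_in_set[OF y] by (simp add: xs(1)[symmetric] xs_eq length_remove1)
      ultimately show False
        unfolding height_def using not_less_Least by blast
    qed
    then have "x \<oplus> y \<in> A0" using metatangible[of x y] x y ys by blast
    then show ?thesis
      using circ_eq_of_add_mem_A0[of x y] x y ys first_kind_circ_tangible[OF True x] by auto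
  qed
  then have "c = [Suc (length ys)] \<cdot> x"
    using lsum_eq_multiple[OF x' ys'] xs(3) xs_eq by simp
  then have "uniform_rep M A0 d c x"
    using x True xs(1) xs_eq by (simp add: uniform_rep_def second_kind_iff del: add.nat_pow_Suc)
  then show ?thesis ..
next
  case False
  then have sk: "second_kind M A0" by (simp add: second_kind_iff)
  obtain a where "a \<in> Tan M" "homogeneous a c" using homogeneous_exists c by blast
  then show ?thesis
    using second_kind_homogeneous[OF sk, of a c] False by (auto simp: uniform_rep_def)
qed

end

section \<open>A criterion for moduli\<close>

lemma target_module_simps [simp]:
  "carrier (target_module M R \<mu>) = carrier R" "add (target_module M R \<mu>) = add R"
  "zero (target_module M R \<mu>) = zero R"
  "lact (target_module M R \<mu>) = mult R" "ract (target_module M R \<mu>) = mult R"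
  "Tan (target_module M R \<mu>) = \<mu> ` Tan M" "unit_T (target_module M R \<mu>) = \<mu> (unit_T M)"
  by (simp_all add: target_module_def)

lemma weakly_admissible_target_module:
  assumes "semiring R" "unit_T M \<in> Tan M" "\<mu> ` Tan M \<subseteq> carrier R"
    and "\<zero>\<^bsub>R\<^esub> \<notin> \<mu> ` Tan M" "\<mu> (unit_T M) = \<one>\<^bsub>R\<^esub>"
  shows "weakly_admissible (target_module M R \<mu>)"
proof -
  interpret semiring R by fact
  have am: "abelian_monoid (target_module M R \<mu>)"
    by (rule abelian_monoidI) (auto simp: a_ac)
  have T: "\<And>a. a \<in> \<mu> ` Tan M \<Longrightarrow> a \<in> carrier R" using assms(3) by blast
  have one: "\<one>\<^bsub>R\<^esub> \<in> \<mu> ` Tan M" using assms(2,5) by (metis imageI)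
  show ?thesis
    by (intro weakly_admissible.intro tbimodule.intro left_tmodule.intro right_tmodule.intro am
        left_tmodule_axioms.intro right_tmodule_axioms.intro tbimodule_axioms.intro
        weakly_admissible_axioms.intro)
      (simp_all add: am assms(3-5) T one m_assoc l_distr r_distr)
qed

context bipotent_mon_pair
begin

text \<open>A function on homogeneous sums that only depends on their common circle value extends to the
  whole of \<open>\<A>\<close>, because that value is determined by the sum and no such sum vanishes.\<close>

lemma homogeneous_function_exists:
  assumes "\<And>n::nat. n \<ge> 1 \<Longrightarrow> [n] \<cdot> \<e> \<noteq> \<zero>"
    and "\<And>a b. \<lbrakk>a \<in> Tan M; b \<in> Tan M; a\<degree> = b\<degree>\<rbrakk> \<Longrightarrow> \<phi> a = \<phi> b"
  shows "\<exists>\<mu>. \<mu> \<zero> = z \<and> (\<forall>a\<in>Tan M. \<forall>c. homogeneous a c \<longrightarrow> \<mu> c = \<phi> a)"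
proof -
  define \<mu> where "\<mu> c = (if c = \<zero> then z else \<phi> (SOME a. a \<in> Tan M \<and> homogeneous a c))" for c
  have "\<mu> c = \<phi> a" if a: "a \<in> Tan M" "homogeneous a c" for a c
  proof -
    define b where "b = (SOME b. b \<in> Tan M \<and> homogeneous b c)"
    have "b \<in> Tan M \<and> homogeneous b c"
      unfolding b_def by (rule someI[of _ a]) (use a in simp)
    then have "\<phi> b = \<phi> a"
      using assms(2) homogeneous_unique a by blast
    then show ?thesis
      using homogeneous_nonzero[OF assms(1) a] by (simp add: \<mu>_def b_def)
  qed
  then show ?thesis by (intro exI[of _ \<mu>]) (simp add: \<mu>_def)
qed

text \<open>Two nonzero elements with different values are homogeneous for tangible elements of which one
  absorbs the other, and this absorption extends to the elements themselves. So the behaviour of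
  \<open>\<mu>\<close> on \<open>\<T>\<close> decides everything.\<close>

lemma T_modulus_homogeneous:
  assumes ndeg: "\<And>n::nat. n \<ge> 1 \<Longrightarrow> [n] \<cdot> \<e> \<noteq> \<zero>"
    and R: "semiring R" "idempotent_on R (carrier R)"
    and zero: "\<mu> \<zero> = \<zero>\<^bsub>R\<^esub>"
    and homog: "\<And>a c. \<lbrakk>a \<in> Tan M; homogeneous a c\<rbrakk> \<Longrightarrow> \<mu> c = \<mu> a"
    and closed: "\<And>a. a \<in> Tan M \<Longrightarrow> \<mu> a \<in> carrier R"
    and nonzero: "\<And>a. a \<in> Tan M \<Longrightarrow> \<mu> a \<noteq> \<zero>\<^bsub>R\<^esub>"
    and one: "\<mu> (unit_T M) = \<one>\<^bsub>R\<^esub>"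
    and mult: "\<And>a b. \<lbrakk>a \<in> Tan M; b \<in> Tan M\<rbrakk> \<Longrightarrow> \<mu> (a \<triangleright> b) = \<mu> a \<otimes>\<^bsub>R\<^esub> \<mu> b"
    and absorb: "\<And>a b. \<lbrakk>a \<in> Tan M; b \<in> Tan M; a \<oplus> b = a\<rbrakk> \<Longrightarrow> \<mu> a \<oplus>\<^bsub>R\<^esub> \<mu> b = \<mu> a"
  shows "T_modulus_to M R \<mu>"
proof -
  interpret R: semiring R by fact
  have idem: "x \<oplus>\<^bsub>R\<^esub> x = x" if "x \<in> carrier R" for x
    using R(2) that by (simp add: idempotent_on_def)
  have circ_eq: "\<mu> a = \<mu> b" if "a \<in> Tan M" "b \<in> Tan M" "a\<degree> = b\<degree>" for a b
    using that homog[of a b] by (simp add: homogeneous.single)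
  have \<mu>_closed: "\<mu> c \<in> carrier R" if "c \<in> carrier M" for c
    using homogeneous_exists[OF that] homog closed zero by auto
  have cases: "b1 = \<zero> \<or> b2 = \<zero> \<or> (\<mu> b1 = \<mu> b2 \<and> \<mu> (b1 \<oplus> b2) = \<mu> b1)
      \<or> (b1 \<oplus> b2 = b1 \<and> \<mu> b1 \<oplus>\<^bsub>R\<^esub> \<mu> b2 = \<mu> b1)
      \<or> (b1 \<oplus> b2 = b2 \<and> \<mu> b1 \<oplus>\<^bsub>R\<^esub> \<mu> b2 = \<mu> b2)"
    if b: "b1 \<in> carrier M" "b2 \<in> carrier M" for b1 b2
  proof (cases "b1 = \<zero> \<or> b2 = \<zero>")
    case False
    then obtain a1 a2 where a: "a1 \<in> Tan M" "homogeneous a1 b1" "a2 \<in> Tan M" "homogeneous a2 b2"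
      using homogeneous_exists b by meson
    then have \<mu>b: "\<mu> b1 = \<mu> a1" "\<mu> b2 = \<mu> a2" using homog by auto
    consider "a1\<degree> = a2\<degree>" | "a1\<degree> \<noteq> a2\<degree>" "a1 \<oplus> a2 = a1" | "a1\<degree> \<noteq> a2\<degree>" "a2 \<oplus> a1 = a2"
      using add_of_circ_neq a by blast
    then show ?thesis
    proof cases
      case 1
      then have "homogeneous a1 (b1 \<oplus> b2)"
        using a homogeneous_add homogeneous_cong by metis
      then show ?thesis using 1 a \<mu>b homog[of a1 "b1 \<oplus> b2"] circ_eq[of a1 a2] by simp
    next
      case 2
      then show ?thesis using homogeneous_absorb[of a1 a2 b1 b2] absorb[of a1 a2] a \<mu>b by simp
    next
      case 3
      then have "b2 \<oplus> b1 = b2" "\<mu> a2 \<oplus>\<^bsub>R\<^esub> \<mu> a1 = \<mu> a2"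
        using homogeneous_absorb[of a2 a1 b2 b1] absorb[of a2 a1] a by auto
      then show ?thesis using a b \<mu>b closed by (simp add: a_comm R.a_comm)
    qed
  qed blast
  have add: "\<mu> (b1 \<oplus> b2) = \<mu> b1 \<oplus>\<^bsub>R\<^esub> \<mu> b2" if "b1 \<in> carrier M" "b2 \<in> carrier M" for b1 b2
    using cases[OF that] that \<mu>_closed idem zero by auto
  have lact: "\<mu> (a \<triangleright> b) = \<mu> a \<otimes>\<^bsub>R\<^esub> \<mu> b" if a: "a \<in> Tan M" and b: "b \<in> carrier M" for a b
  proof (cases "b = \<zero>")
    case True
    then show ?thesis using a closed by (simp add: lact_zero zero)
  next
    case False
    then obtain t where t: "t \<in> Tan M" "homogeneous t b" using homogeneous_exists b by blast
    then show ?thesis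
      using homog[of t b] homog[of "a \<triangleright> t" "a \<triangleright> b"] a homogeneous_lact mult
      by (simp add: tangible_lact_closed)
  qed
  have weak: "b1 \<oplus> b2 = b1"
    if b: "b1 \<in> carrier M" "b2 \<in> carrier M" and \<mu>: "\<mu> b1 \<noteq> \<mu> b2" "\<mu> b1 \<oplus>\<^bsub>R\<^esub> \<mu> b2 = \<mu> b1" for b1 b2
    using cases[OF b] b \<mu> zero \<mu>_closed by auto
  have bip: "\<mu> b1 \<oplus>\<^bsub>R\<^esub> \<mu> b2 \<in> {\<mu> b1, \<mu> b2}" if b: "b1 \<in> carrier M" "b2 \<in> carrier M" for b1 b2
    using cases[OF b] b zero \<mu>_closed idem by auto
  have mono: "\<mu> (a1 \<otimes>\<^bsub>tangible M\<^esub> a2) \<oplus>\<^bsub>R\<^esub> \<mu> (a1' \<otimes>\<^bsub>tangible M\<^esub> a2') = \<mu> (a1' \<otimes>\<^bsub>tangible M\<^esub> a2')"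
    if T: "a1 \<in> Tan M" "a2 \<in> Tan M" "a1' \<in> Tan M" "a2' \<in> Tan M"
      and le: "\<mu> a1 \<oplus>\<^bsub>R\<^esub> \<mu> a1' = \<mu> a1'" "\<mu> a2 \<oplus>\<^bsub>R\<^esub> \<mu> a2' = \<mu> a2'" for a1 a2 a1' a2'
  proof -
    note T' = T[THEN closed]
    have 1: "\<mu> a1' \<otimes>\<^bsub>R\<^esub> \<mu> a2' = \<mu> a1 \<otimes>\<^bsub>R\<^esub> \<mu> a2' \<oplus>\<^bsub>R\<^esub> \<mu> a1' \<otimes>\<^bsub>R\<^esub> \<mu> a2'"
      using R.l_distr[of "\<mu> a1" "\<mu> a1'" "\<mu> a2'"] T' le by simp
    have 2: "\<mu> a1 \<otimes>\<^bsub>R\<^esub> \<mu> a2' = \<mu> a1 \<otimes>\<^bsub>R\<^esub> \<mu> a2 \<oplus>\<^bsub>R\<^esub> \<mu> a1 \<otimes>\<^bsub>R\<^esub> \<mu> a2'"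
      using R.r_distr[of "\<mu> a2" "\<mu> a2'" "\<mu> a1"] T' le by simp
    have "\<mu> a1 \<otimes>\<^bsub>R\<^esub> \<mu> a2 \<oplus>\<^bsub>R\<^esub> (\<mu> a1 \<otimes>\<^bsub>R\<^esub> \<mu> a2' \<oplus>\<^bsub>R\<^esub> \<mu> a1' \<otimes>\<^bsub>R\<^esub> \<mu> a2')
        = \<mu> a1 \<otimes>\<^bsub>R\<^esub> \<mu> a2' \<oplus>\<^bsub>R\<^esub> \<mu> a1' \<otimes>\<^bsub>R\<^esub> \<mu> a2'"
      using T' 2 by (simp add: R.a_assoc[symmetric])
    then show ?thesis
      using T 1 by (simp add: tangible_mult mult)
  qed
  have "\<zero>\<^bsub>R\<^esub> \<notin> \<mu> ` Tan M" using nonzero by (metis imageE)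
  then have "weakly_admissible (target_module M R \<mu>)"
    using closed by (intro weakly_admissible_target_module R(1) unit_T_closed one) auto
  then have hom: "tmod_hom M (target_module M R \<mu>) \<mu>"
    unfolding tmod_hom_def
    using weakly_admissible_axioms add lact \<mu>_closed zero by auto
  have weak_mod: "weak_modulus M (target_module M R \<mu>) \<mu>"
    unfolding weak_modulus_def
    using hom R(2) weak nonzero[OF unit_T_closed] tangible_closed[OF unit_T_closed]
    by (auto simp: idempotent_on_def)
  have "modulus M (target_module M R \<mu>) \<mu>"
    unfolding modulus_def
    using weak_mod bip mono by (simp add: bipotent_on_def add_le_def)
  moreover have "\<mu> ` Tan M = \<mu> ` (carrier M - {\<zero>})"
  proof
    show "\<mu> ` Tan M \<subseteq> \<mu> ` (carrier M - {\<zero>})"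
      using tangible_subset zero_not_tangible by blast
    show "\<mu> ` (carrier M - {\<zero>}) \<subseteq> \<mu> ` Tan M"
    proof
      fix y assume "y \<in> \<mu> ` (carrier M - {\<zero>})"
      then obtain c where "c \<in> carrier M" "c \<noteq> \<zero>" "y = \<mu> c" by blast
      then show "y \<in> \<mu> ` Tan M" using homogeneous_exists homog by (metis imageI)
    qed
  qed
  ultimately show ?thesis by (simp add: T_modulus_def)
qed

lemma given_by_circ_of_rep_homogeneous:
  assumes "\<mu> \<zero> = \<zero>" "\<And>a c. \<lbrakk>a \<in> Tan M; homogeneous a c\<rbrakk> \<Longrightarrow> \<mu> c = a\<degree>"
  shows "given_by_circ_of_rep M A0 d \<mu>"
  unfolding given_by_circ_of_rep_def
proof (intro conjI ballI allI impI)
  show "\<mu> \<zero> = \<zero>" by fact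
  fix c assume c: "c \<in> carrier M - {\<zero>}"
  then show "\<exists>a. uniform_rep M A0 d c a" using uniform_rep_exists by blast
  fix a assume a: "uniform_rep M A0 d c a"
  then have "a \<in> Tan M" by (simp add: uniform_rep_def)
  then show "\<mu> c = a\<degree>" using assms(2) homogeneous_of_uniform_rep[OF a] c by blast
qed


section \<open>The semiring of circle values\<close>

lemma Todot_semiring_simps [simp]:
  "carrier (Todot_semiring M d) = circle ` Tan0 M" "mult (Todot_semiring M d) = odot M d"
  "one (Todot_semiring M d) = \<e>" "zero (Todot_semiring M d) = \<zero>"
  "add (Todot_semiring M d) = dotplus M"
  by (simp_all add: Todot_semiring_def)

lemma Tan0_add_of_circ_neq:
  assumes "a \<in> Tan0 M" "b \<in> Tan0 M" "a\<degree> \<noteq> b\<degree>"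
  shows "a \<oplus> b \<in> {a, b}"
  using assms add_of_circ_neq[of a b] by (auto simp: tangible_closed a_comm)

lemma dotplus_circ:
  assumes "a \<in> Tan0 M" "b \<in> Tan0 M" "a\<degree> \<noteq> b\<degree>"
  shows "dotplus M (a\<degree>) (b\<degree>) = (a \<oplus> b)\<degree>" "(a \<oplus> b)\<degree> = a\<degree> \<oplus> b\<degree>"
  using assms circ_add[OF Tan0_closed Tan0_closed, OF assms(1,2)] by (auto simp: dotplus_def)

lemma dotplus_mem:
  assumes "x \<in> circle ` Tan0 M" "y \<in> circle ` Tan0 M"
  shows "dotplus M x y \<in> {x, y}"
proof (cases "x = y")
  case False
  obtain a b where ab: "a \<in> Tan0 M" "b \<in> Tan0 M" "x = a\<degree>" "y = b\<degree>" using assms by blast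
  then show ?thesis
    using False dotplus_circ(1)[of a b] Tan0_add_of_circ_neq[of a b] by auto
qed (simp add: dotplus_def)

lemma odot_lact:
  assumes "a \<in> Tan M" "y \<in> circle ` Tan0 M"
  shows "odot M d (a\<degree>) y = a \<triangleright> y"
proof -
  obtain b where b: "b \<in> Tan0 M" "y = b\<degree>" using assms by blast
  then show ?thesis
    using assms(1) odot_circ[of a b] circ_lact[of a b] Tan0_closed[of b]
    by (simp add: Tan0_mult_left)
qed

lemma odot_ract:
  assumes "a \<in> Tan M" "y \<in> circle ` Tan0 M"
  shows "odot M d y (a\<degree>) = y \<triangleleft> a"
proof -
  obtain b where b: "b \<in> Tan0 M" "y = b\<degree>" using assms by blast
  have "b \<otimes>\<^bsub>Tan0_monoid M\<^esub> a = b \<triangleleft> a"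
    using b(1) assms(1) by (auto simp: Tan0_mult_tangible ract_eq_lact ract_zero)
  then show ?thesis
    using b assms(1) odot_circ[of b a] circ_ract[of a b] Tan0_closed[of b] by simp
qed

text \<open>Sums of distinct circle values are sums in \<open>\<A>\<close>, so for pairwise distinct values the semiring
  laws are inherited; when two values coincide, associativity follows from bipotence.
  Distributivity uses that a tangible element acts injectively, so it keeps distinct values
  distinct.\<close>

lemma semiring_Todot: "semiring (Todot_semiring M d)"
proof -
  let ?S = "circle ` Tan0 M"
  interpret T: monoid "Todot_monoid M d" by (rule monoid_Todot)
  have S: "x \<in> carrier M" if "x \<in> ?S" for x using that circ_closed Tan0_closed by auto
  have zero: "\<zero> \<in> ?S"
    by (rule image_eqI[of _ _ \<zero>]) (simp_all only: circ_zero insertI1)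
  have zero_mult: "odot M d \<zero> x = \<zero>" "odot M d x \<zero> = \<zero>" if "x \<in> ?S" for x
  proof -
    from that obtain a where a: "x = a\<degree>" "a \<in> Tan0 M" by (rule imageE)
    show "odot M d \<zero> x = \<zero>" "odot M d x \<zero> = \<zero>"
      using odot_circ[of \<zero> a] odot_circ[of a \<zero>] a(2)
      by (simp_all only: a(1) circ_zero insertI1 Tan0_monoid_simps)
  qed
  have comm: "dotplus M x y = dotplus M y x" if "x \<in> ?S" "y \<in> ?S" for x y
    using that S by (auto simp: dotplus_def a_comm simp del: insert_iff image_insert)
  have assoc: "dotplus M (dotplus M x y) z = dotplus M x (dotplus M y z)"
    if xyz: "x \<in> ?S" "y \<in> ?S" "z \<in> ?S" for x y z
  proof -
    have mem: "dotplus M x y = x \<or> dotplus M x y = y" "dotplus M y z = y \<or> dotplus M y z = z"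
        "dotplus M x z = x \<or> dotplus M x z = z"
      using dotplus_mem[OF xyz(1,2)] dotplus_mem[OF xyz(2,3)] dotplus_mem[OF xyz(1,3)]
      by simp_all
    have idem: "dotplus M w w = w" for w by (simp add: dotplus_def)
    note carr = S[OF xyz(1)] S[OF xyz(2)] S[OF xyz(3)]
    consider "x = y" | "y = z" | "x = z" | "x \<noteq> y" "y \<noteq> z" "x \<noteq> z" by blast
    then show ?thesis
    proof cases
      case 1
      then show ?thesis using mem(2) idem by metis
    next
      case 2
      then show ?thesis using mem(1) idem by metis
    next
      case 3
      then show ?thesis using comm dotplus_mem[OF xyz(1,2)] xyz idem by (metis insertE singletonD)
    next
      case 4
      then have "dotplus M x y \<noteq> z" "x \<noteq> dotplus M y z" using mem by metis+
      with 4 show ?thesis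
        using a_assoc[OF carr] by (simp only: dotplus_def if_False)
    qed
  qed
  have r_distr: "odot M d z (dotplus M x y) = dotplus M (odot M d z x) (odot M d z y)"
    if xyz: "x \<in> ?S" "y \<in> ?S" "z \<in> ?S" for x y z
  proof -
    obtain a where a: "a \<in> Tan0 M" "z = a\<degree>" using xyz by blast
    have xy: "dotplus M x y \<in> ?S" using dotplus_mem xyz by blast
    show ?thesis
    proof (cases "a = \<zero>")
      case True
      then show ?thesis using a xyz xy zero_mult by (simp add: dotplus_def del: image_insert)
    next
      case False
      then have T: "a \<in> Tan M" using a by simp
      then show ?thesis
        using a(2) xyz xy S lact_cancel[OF T, of x y]
        by (auto simp: odot_lact dotplus_def lact_add simp del: image_insert)
    qed
  qed
  have l_distr: "odot M d (dotplus M x y) z = dotplus M (odot M d x z) (odot M d y z)"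
    if xyz: "x \<in> ?S" "y \<in> ?S" "z \<in> ?S" for x y z
  proof -
    obtain a where a: "a \<in> Tan0 M" "z = a\<degree>" using xyz by blast
    have xy: "dotplus M x y \<in> ?S" using dotplus_mem xyz by blast
    show ?thesis
    proof (cases "a = \<zero>")
      case True
      then show ?thesis using a xyz xy zero_mult by (simp add: dotplus_def del: image_insert)
    next
      case False
      then have T: "a \<in> Tan M" using a by simp
      then show ?thesis
        using a(2) xyz xy S ract_cancel[OF T, of x y]
        by (auto simp: odot_ract dotplus_def ract_add simp del: image_insert)
    qed
  qed
  have dp0: "dotplus M \<zero> x = x" if "x \<in> ?S" for x
    using S[OF that] by (simp add: dotplus_def)
  have dp_closed: "dotplus M x y \<in> ?S" if "x \<in> ?S" "y \<in> ?S" for x y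
    using dotplus_mem[OF that] that by blast
  show ?thesis
    by (intro semiring.intro abelian_monoidI monoidI semiring_axioms.intro,
        unfold Todot_semiring_simps)
      (fact zero zero_mult comm assoc r_distr l_distr dp0 dp_closed
        T.m_closed[unfolded Todot_monoid_simps] T.m_assoc[unfolded Todot_monoid_simps]
        T.one_closed[unfolded Todot_monoid_simps] T.l_one[unfolded Todot_monoid_simps]
        T.r_one[unfolded Todot_monoid_simps])+
qed

lemma idempotent_Todot: "idempotent_on (Todot_semiring M d) (carrier (Todot_semiring M d))"
  by (simp add: idempotent_on_def dotplus_def)

lemma T_modulus_Todot:
  assumes "first_kind M A0 \<Longrightarrow> unit_multiples_nonzero M"
  shows "\<exists>\<mu>. given_by_circ_of_rep M A0 d \<mu> \<and> T_modulus_to M (Todot_semiring M d) \<mu>"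
proof -
  have ndeg: "[n] \<cdot> \<e> \<noteq> \<zero>" if "n \<ge> 1" for n :: nat
    using unit_circle_multiples_nonzero[OF assms that] .
  obtain \<mu> where \<mu>: "\<mu> \<zero> = \<zero>" "\<And>a c. \<lbrakk>a \<in> Tan M; homogeneous a c\<rbrakk> \<Longrightarrow> \<mu> c = a\<degree>"
    using homogeneous_function_exists[of circle \<zero>, OF ndeg] by blast
  have \<mu>_tangible: "\<mu> a = a\<degree>" if "a \<in> Tan M" for a
    using \<mu>(2) homogeneous_self that by blast
  have "T_modulus_to M (Todot_semiring M d) \<mu>"
  proof (rule T_modulus_homogeneous[OF ndeg semiring_Todot idempotent_Todot])
    fix a b assume ab: "a \<in> Tan M" "b \<in> Tan M"
    show "\<mu> (a \<triangleright> b) = \<mu> a \<otimes>\<^bsub>Todot_semiring M d\<^esub> \<mu> b"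
      using ab by (simp add: \<mu>_tangible tangible_lact_closed odot_circ Tan0_mult_tangible)
    assume "a \<oplus> b = a"
    then show "\<mu> a \<oplus>\<^bsub>Todot_semiring M d\<^esub> \<mu> b = \<mu> a"
      using ab circ_add[of a b] by (simp add: \<mu>_tangible dotplus_def tangible_closed)
  next
    fix a assume a: "a \<in> Tan M"
    show "\<mu> a \<in> carrier (Todot_semiring M d)" using a by (simp add: \<mu>_tangible)
    show "\<mu> c = \<mu> a" if "homogeneous a c" for c using \<mu>(2) \<mu>_tangible a that by metis
    have "\<e> \<noteq> \<zero>" using ndeg[of 1] unit_circle_closed by simp
    then show "\<mu> a \<noteq> \<zero>\<^bsub>Todot_semiring M d\<^esub>"
      using a circ_tangible_eq_zero by (auto simp: \<mu>_tangible)
  qed (simp_all add: \<mu>(1) \<mu>_tangible unit_T_closed)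
  moreover have "given_by_circ_of_rep M A0 d \<mu>"
    using \<mu> by (rule given_by_circ_of_rep_homogeneous)
  ultimately show ?thesis by blast
qed


section \<open>The second kind: circle values inside \<open>\<A>\<^sub>0\<close>\<close>

text \<open>The circle map is multiplication by \<open>1\<degree>\<close>.\<close>

lemma amult_unit_circle:
  assumes "x \<in> carrier M"
  shows "amult M \<e> x = x\<degree>" "amult M x \<e> = x\<degree>"
proof -
  interpret S: semiring "semiring_of M" by (rule semiring_semiring_of)
  have e: "\<e> = unit_T M \<oplus> d" by (simp add: circ_def ract_on_unit dag_tangible)
  note T = unit_T_closed dag_tangible
  show "amult M \<e> x = x\<degree>"
    using assms S.l_distr[of "unit_T M" d x] T
    by (simp add: e circ_def ract_on_unit tangible_closed amult_tangible_left lact_unit dag_central)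
  show "amult M x \<e> = x\<degree>"
    using assms S.r_distr[of "unit_T M" d x] T
    by (simp add: e circ_def ract_on_unit tangible_closed amult_tangible_right ract_unit)
qed

lemma amult_mem_A0:
  assumes "x \<in> carrier M" "y \<in> A0"
  shows "amult M x y \<in> A0"
  using assms(1)
proof (induction rule: carrier_induct)
  case zero
  then show ?case using assms(2) A0_subset by (auto simp: amult_zero_left A0_zero)
next
  case (add a x)
  have "y \<in> carrier M" using assms(2) A0_subset by blast
  then show ?case
    using add assms(2)
    by (simp add: amult_add_left(1) tangible_closed amult_tangible_left A0_add A0_lact)
qed

text \<open>Since \<open>\<A>\<close> is additively idempotent, nonzero elements of \<open>\<A>\<^sub>0\<close> are circle values and are fixed
  by the circle map; so \<open>1\<degree>\<close> is a unit of \<open>\<A>\<^sub>0\<close>, and the circle map sends both \<open>a\<close> and \<open>a\<degree>\<close>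
  to \<open>a\<degree>\<close>.\<close>

lemma T_modulus_circ_second_kind:
  assumes sk: "second_kind M A0"
  shows "T_modulus_to M (restrict_semiring (semiring_of M) A0 \<e>) circle"
proof -
  let ?R = "restrict_semiring (semiring_of M) A0 \<e>"
  have A0: "x \<in> carrier M" if "x \<in> A0" for x using that A0_subset by blast
  have circ_circ: "(a\<degree>)\<degree> = a\<degree>" if "a \<in> Tan M" for a
    using circ_circ_tangible[OF that] second_kind_idem[OF sk circ_closed] that
    by (simp add: tangible_closed)
  have circ_A0: "x\<degree> = x" if "x \<in> A0" for x
  proof (cases "x = \<zero>")
    case False
    then obtain a where "a \<in> Tan M" "homogeneous a x" using homogeneous_exists A0 \<open>x \<in> A0\<close> by blast
    then show ?thesis
      using second_kind_homogeneous[OF sk] tangible_notin_A0 that circ_circ by blast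
  qed simp
  have ndeg: "[n] \<cdot> \<e> \<noteq> \<zero>" if "n \<ge> 1" for n :: nat
    using unit_circle_multiples_nonzero[OF _ that] sk by (simp add: second_kind_iff)
  have R: "semiring ?R"
    by (rule semiring_restrict[OF semiring_semiring_of])
      (use A0_subset A0_zero A0_add amult_mem_A0 A0 circ_mem_A0 amult_unit_circle circ_A0
        tangible_closed unit_T_closed in auto)
  have R_idem: "idempotent_on ?R (carrier ?R)"
    using second_kind_idem[OF sk] A0 by (simp add: idempotent_on_def)
  show ?thesis
  proof (rule T_modulus_homogeneous[OF ndeg R R_idem])
    fix a b assume ab: "a \<in> Tan M" "b \<in> Tan M"
    have "amult M (a\<degree>) (b\<degree>) = a \<triangleright> amult M \<e> (b\<degree>)"
      using ab
      by (simp add: circ_tangible[of a] amult_tangible_assoc unit_circle_closed circ_closed tangible_closed)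
    also have "\<dots> = (a \<triangleright> b)\<degree>"
      using ab by (simp add: amult_unit_circle circ_closed tangible_closed circ_circ circ_lact)
    finally show "(a \<triangleright> b)\<degree> = a\<degree> \<otimes>\<^bsub>?R\<^esub> b\<degree>" by simp
    assume "a \<oplus> b = a"
    then show "a\<degree> \<oplus>\<^bsub>?R\<^esub> b\<degree> = a\<degree>"
      using ab circ_add[of a b] by (simp add: tangible_closed)
  next
    fix a assume a: "a \<in> Tan M"
    show "a\<degree> \<in> carrier ?R" using a by (simp add: circ_mem_A0 tangible_closed)
    show "a\<degree> \<noteq> \<zero>\<^bsub>?R\<^esub>"
      using a circ_tangible_eq_zero second_kind_unit_circle_nonzero[OF sk] by auto
    fix c assume "homogeneous a c"
    then show "c\<degree> = a\<degree>" using second_kind_homogeneous[OF sk a] circ_circ[OF a] by auto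
  qed simp_all
qed

lemma dotplus_second_kind:
  assumes "second_kind M A0" "x \<in> circle ` Tan0 M"
  shows "dotplus M x y = x \<oplus> y"
  using assms second_kind_idem[OF assms(1)] by (auto simp: dotplus_def circ_closed tangible_closed)


section \<open>The first kind: multiples by the period\<close>

lemma amult_multiple_unit:
  fixes m :: nat
  assumes "x \<in> carrier M"
  shows "amult M ([m] \<cdot> unit_T M) x = [m] \<cdot> x" "amult M x ([m] \<cdot> unit_T M) = [m] \<cdot> x"
proof -
  interpret S: semiring "semiring_of M" by (rule semiring_semiring_of)
  have u: "unit_T M \<in> carrier M" by (simp add: tangible_closed unit_T_closed)
  show "amult M ([m] \<cdot> unit_T M) x = [m] \<cdot> x"
  proof (induction m)
    case (Suc m)
    then show ?case
      using assms u by (simp add: amult_add_left(1) amult_tangible_left unit_T_closed lact_unit)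
  qed (simp add: assms amult_zero_left)
  show "amult M x ([m] \<cdot> unit_T M) = [m] \<cdot> x"
  proof (induction m)
    case 0
    then show ?case using S.r_null[of x] assms by simp
  next
    case (Suc m)
    then show ?case
      using assms u S.r_distr[of "[m] \<cdot> unit_T M" "unit_T M" x]
      by (simp add: amult_tangible_right unit_T_closed ract_unit)
  qed
qed

context
  fixes m :: nat
  assumes fk: "first_kind M A0"
    and m_pos: "m \<ge> 1"
    and m_idem: "[m] \<cdot> unit_T M \<oplus> [m] \<cdot> unit_T M = [m] \<cdot> unit_T M"
begin

abbreviation multiples :: "'a set"
  where "multiples \<equiv> (\<lambda>a. [m] \<cdot> a) ` Tan0 M"

abbreviation multiples_semiring :: "'a ring"
  where "multiples_semiring \<equiv> restrict_semiring (semiring_of M) multiples ([m] \<cdot> unit_T M)"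

lemma multiple_idem:
  assumes "x \<in> carrier M"
  shows "[m] \<cdot> x \<oplus> [m] \<cdot> x = [m] \<cdot> x"
proof -
  have u: "[m] \<cdot> unit_T M \<in> carrier M" by (simp add: tangible_closed unit_T_closed)
  show ?thesis
    using amult_add_left(1)[OF u u assms] by (simp add: m_idem amult_multiple_unit assms)
qed

text \<open>Both sides equal \<open>m (a + a) = m a\<degree>\<close>, because \<open>m a\<close> is additively idempotent.\<close>

lemma multiple_cong:
  assumes "a \<in> Tan M" "b \<in> Tan M" "a\<degree> = b\<degree>"
  shows "[m] \<cdot> a = [m] \<cdot> b"
proof -
  have double: "[m] \<cdot> a = [m] \<cdot> a\<degree>" if "a \<in> Tan M" for a
    using that multiple_idem[of a] add.nat_pow_distrib[of a a m]
    by (simp add: first_kind_circ_tangible[OF fk] tangible_closed)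
  show ?thesis using double[OF assms(1)] double[OF assms(2)] assms(3) by simp
qed

lemma multiple_multiple: "x \<in> carrier M \<Longrightarrow> [m] \<cdot> ([m] \<cdot> x) = [m] \<cdot> x"
  using add_pow_idem[OF _ _ m_pos, of "[m] \<cdot> x"] multiple_idem by simp

text \<open>If \<open>a\<degree> = b\<degree>\<close>, the two multiples coincide and are idempotent; otherwise \<open>a + b\<close> is one of the
  summands.\<close>

lemma add_multiples:
  assumes "a \<in> Tan0 M" "b \<in> Tan0 M"
  shows "[m] \<cdot> a \<oplus> [m] \<cdot> b \<in> {[m] \<cdot> a, [m] \<cdot> b}"
proof (cases "a\<degree> = b\<degree>")
  case True
  show ?thesis
  proof (cases "a = \<zero> \<or> b = \<zero>")
    case False
    then have "[m] \<cdot> a = [m] \<cdot> b" using True assms multiple_cong[of a b] by simp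
    then show ?thesis using multiple_idem[of b] assms(2) Tan0_closed[of b] by simp
  next
    case True
    then show ?thesis using assms[THEN Tan0_closed] by auto
  qed
next
  case False
  have "[m] \<cdot> a \<oplus> [m] \<cdot> b = [m] \<cdot> (a \<oplus> b)"
    using assms[THEN Tan0_closed] by (simp add: add.nat_pow_distrib)
  then show ?thesis using Tan0_add_of_circ_neq[OF assms False] by auto
qed

lemma amult_multiples:
  assumes "a \<in> Tan0 M" "b \<in> Tan0 M"
  shows "amult M ([m] \<cdot> a) ([m] \<cdot> b) = [m] \<cdot> (a \<otimes>\<^bsub>Tan0_monoid M\<^esub> b)"
proof (cases "a = \<zero>")
  case True
  then show ?thesis using assms Tan0_closed by (simp add: amult_zero_left)
next
  case False
  then have a: "a \<in> Tan M" using assms by simp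
  have u: "unit_T M \<in> carrier M" by (simp add: tangible_closed unit_T_closed)
  have b: "b \<in> carrier M" using assms Tan0_closed by blast
  have "[m] \<cdot> a = a \<triangleright> ([m] \<cdot> unit_T M)"
    using a u by (simp add: lact_add_pow lact_on_unit)
  then have "amult M ([m] \<cdot> a) ([m] \<cdot> b) = a \<triangleright> amult M ([m] \<cdot> unit_T M) ([m] \<cdot> b)"
    using a b u by (simp only: amult_tangible_assoc add.nat_pow_closed)
  also have "\<dots> = a \<triangleright> ([m] \<cdot> b)"
    using b by (simp add: amult_multiple_unit multiple_multiple)
  finally show ?thesis
    using a b assms(2) by (simp add: Tan0_mult_left lact_add_pow)
qed

lemma multiples_closed: "x \<in> multiples \<Longrightarrow> x \<in> carrier M"
  using Tan0_closed by auto

lemma semiring_multiples: "semiring multiples_semiring"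
proof (rule semiring_restrict[OF semiring_semiring_of])
  fix x y assume "x \<in> multiples" "y \<in> multiples"
  then obtain a b where ab: "a \<in> Tan0 M" "b \<in> Tan0 M" "x = [m] \<cdot> a" "y = [m] \<cdot> b" by blast
  then show "x \<oplus>\<^bsub>semiring_of M\<^esub> y \<in> multiples"
    using add_multiples[of a b] by auto
  show "x \<otimes>\<^bsub>semiring_of M\<^esub> y \<in> multiples"
    using ab Tan0_mult_closed[of a b] by (simp add: amult_multiples del: insert_iff image_insert)
next
  show "\<zero>\<^bsub>semiring_of M\<^esub> \<in> multiples"
    using image_eqI[of \<zero> "\<lambda>a. [m] \<cdot> a" \<zero> "Tan0 M"] by simp
  show "[m] \<cdot> unit_T M \<in> multiples" using unit_T_closed by blast
  show "multiples \<subseteq> carrier (semiring_of M)" using multiples_closed by auto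
next
  fix x assume "x \<in> multiples"
  then obtain a where "x = [m] \<cdot> a" "a \<in> carrier M" using Tan0_closed by blast
  then show "[m] \<cdot> unit_T M \<otimes>\<^bsub>semiring_of M\<^esub> x = x" "x \<otimes>\<^bsub>semiring_of M\<^esub> [m] \<cdot> unit_T M = x"
    by (simp_all add: amult_multiple_unit multiple_multiple)
qed

lemma sub_semiring_multiples: "sub_semiring (semiring_of M) multiples ([m] \<cdot> unit_T M)"
proof -
  have "\<zero> \<in> multiples"
    using image_eqI[of \<zero> "\<lambda>a. [m] \<cdot> a" \<zero> "Tan0 M"] by simp
  then show ?thesis
    unfolding sub_semiring_def semiring_of_carrier
    using semiring_semiring_of semiring_multiples multiples_closed by blast
qed

lemma bipotent_multiples: "bipotent_on (semiring_of M) multiples"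
  unfolding bipotent_on_def semiring_of_carrier
  by (intro ballI, elim imageE) (simp only: add_multiples)

lemma T_modulus_multiples:
  assumes "unit_multiples_nonzero M"
  shows "\<exists>\<mu>. \<mu> \<zero> = \<zero> \<and> (\<forall>a\<in>Tan M. \<forall>c. homogeneous a c \<longrightarrow> \<mu> c = [m] \<cdot> a)
    \<and> T_modulus_to M multiples_semiring \<mu>"
proof -
  have ndeg: "[n] \<cdot> \<e> \<noteq> \<zero>" if "n \<ge> 1" for n :: nat
    using unit_circle_multiples_nonzero[OF assms that] .
  obtain \<mu> where \<mu>: "\<mu> \<zero> = \<zero>" "\<And>a c. \<lbrakk>a \<in> Tan M; homogeneous a c\<rbrakk> \<Longrightarrow> \<mu> c = [m] \<cdot> a"
    using homogeneous_function_exists[of "\<lambda>a. [m] \<cdot> a" \<zero>, OF ndeg] multiple_cong by blast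
  have \<mu>_tangible: "\<mu> a = [m] \<cdot> a" if "a \<in> Tan M" for a
    using \<mu>(2) homogeneous_self that by blast
  have idem: "idempotent_on multiples_semiring (carrier multiples_semiring)"
    using multiple_idem Tan0_closed by (auto simp: idempotent_on_def)
  have "T_modulus_to M multiples_semiring \<mu>"
  proof (rule T_modulus_homogeneous[OF ndeg semiring_multiples idem])
    fix a b assume ab: "a \<in> Tan M" "b \<in> Tan M"
    show "\<mu> (a \<triangleright> b) = \<mu> a \<otimes>\<^bsub>multiples_semiring\<^esub> \<mu> b"
      using ab by (simp add: \<mu>_tangible tangible_lact_closed amult_multiples Tan0_mult_tangible)
    assume "a \<oplus> b = a"
    then show "\<mu> a \<oplus>\<^bsub>multiples_semiring\<^esub> \<mu> b = \<mu> a"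
      using ab add.nat_pow_distrib[of a b m] by (simp add: \<mu>_tangible tangible_closed)
  next
    fix a assume a: "a \<in> Tan M"
    show "\<mu> a \<in> carrier multiples_semiring" using a by (simp add: \<mu>_tangible)
    show "\<mu> c = \<mu> a" if "homogeneous a c" for c using \<mu>(2) \<mu>_tangible a that by metis
    show "\<mu> a \<noteq> \<zero>\<^bsub>multiples_semiring\<^esub>"
      using homogeneous_nonzero[OF ndeg a homogeneous_add_pow[OF a m_pos]] a
      by (simp add: \<mu>_tangible)
  qed (simp_all add: \<mu>(1) \<mu>_tangible unit_T_closed)
  with \<mu> show ?thesis by blast
qed

end

text \<open>All multiples of \<open>1\<close> from \<open>2\<close> on coincide, while \<open>1 + 1 \<noteq> 1\<close> because \<open>1 + 1\<close> lies in \<open>\<A>\<^sub>0\<close>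
  and \<open>1\<close> does not. If \<open>2 \<cdot> 1\<close> were \<open>0\<close>, then \<open>1 = 1 + 2 \<cdot> 1 = 2 \<cdot> 1 = 0\<close>.\<close>

lemma characteristic_1_2:
  assumes fk: "first_kind M A0" and char: "has_characteristic M 1 2"
  shows "has_period M 2" "unit_multiples_nonzero M"
proof -
  let ?u = "unit_T M"
  have u: "?u \<in> carrier M" by (simp add: tangible_closed unit_T_closed)
  have not_idem: "?u \<oplus> ?u \<noteq> ?u"
    using fk tangible_notin_A0[OF unit_T_closed] by (auto simp: first_kind_def)
  have three: "?u \<oplus> [(2::nat)] \<cdot> ?u = [(2::nat)] \<cdot> ?u"
    using char u by (simp add: has_characteristic_def char_rel_def)
  have stable: "[k] \<cdot> ?u = [(2::nat)] \<cdot> ?u" if "k \<ge> 2" for k :: nat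
    using that by (induction k rule: dec_induct) (use three u in \<open>auto simp: a_comm\<close>)
  have four: "[(2::nat)] \<cdot> ?u \<oplus> [(2::nat)] \<cdot> ?u = [(2::nat)] \<cdot> ?u"
    using stable[of 4] u by (simp add: add.nat_pow_mult)
  have least: "2 \<le> k" if "k \<ge> 1" "[k] \<cdot> ?u \<oplus> [k] \<cdot> ?u = [k] \<cdot> ?u" for k :: nat
  proof (rule ccontr)
    assume "\<not> 2 \<le> k"
    then have "k = 1" using that by simp
    then show False using that not_idem u by simp
  qed
  show "has_period M 2"
    unfolding has_period_def using char four least by auto
  have "[k] \<cdot> ?u \<noteq> \<zero>" if "k \<ge> 1" for k :: nat
  proof (cases "k \<ge> 2")
    case True
    have "[(2::nat)] \<cdot> ?u \<noteq> \<zero>"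
      using three u unit_T_closed zero_not_tangible by force
    then show ?thesis using stable[OF True] by simp
  next
    case False
    then have "k = 1" using that by simp
    then show ?thesis using u unit_T_closed zero_not_tangible by auto
  qed
  then show "unit_multiples_nonzero M" by (simp add: unit_multiples_nonzero_def)
qed

text \<open>Since \<open>2 a = a\<degree>\<close> is idempotent, every nonzero circle value in \<open>\<A>\<^sup>\<circ>\<close> is some \<open>2 a\<close>. So
  \<open>\<A>\<^sup>\<circ>\<close> is \<open>m \<T>\<^sub>0\<close> for the period \<open>m = 2\<close>, and \<open>1\<degree>\<close> is the unit \<open>m 1\<close>.\<close>

lemma T_modulus_characteristic_1_2:
  assumes fk: "first_kind M A0" and char: "has_characteristic M 1 2"
  shows "\<exists>\<mu>. given_by_circ_of_rep M A0 d \<mu>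
    \<and> (\<forall>a\<in>Tan M. \<forall>k::nat. 1 < k \<longrightarrow> \<mu> ([k] \<cdot> a) = a \<oplus> a \<and> a \<oplus> a = a\<degree>)
    \<and> T_modulus_to M (restrict_semiring (semiring_of M) (circle ` carrier M) \<e>) \<mu>"
proof -
  have period: "(2::nat) \<ge> 1" "[(2::nat)] \<cdot> unit_T M \<oplus> [(2::nat)] \<cdot> unit_T M = [(2::nat)] \<cdot> unit_T M"
    using characteristic_1_2[OF assms] by (auto simp: has_period_def)
  have double: "[(2::nat)] \<cdot> a = a\<degree>" if "a \<in> Tan M" for a
    using first_kind_circ_tangible[OF fk that] that by (simp add: numeral_2_eq_2 tangible_closed)
  have idem: "a\<degree> \<oplus> a\<degree> = a\<degree>" if "a \<in> Tan M" for a
    using multiple_idem[OF fk period tangible_closed[OF that]] double[OF that] by simp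
  have "c\<degree> \<in> circle ` Tan0 M" if "c \<in> carrier M" for c
  proof (cases "c = \<zero>")
    case False
    with that obtain a where a: "a \<in> Tan M" "homogeneous a c" using homogeneous_exists by blast
    obtain n :: nat where n: "n \<ge> 1" "c\<degree> = [n] \<cdot> a\<degree>"
      using circ_homogeneous[OF a(2,1)] by blast
    then have "c\<degree> = a\<degree>"
      using add_pow_idem[OF circ_closed[OF tangible_closed[OF a(1)]] idem[OF a(1)] n(1)] by simp
    with a show ?thesis by blast
  qed simp
  then have "circle ` carrier M = circle ` Tan0 M"
    using Tan0_closed by blast
  also have "\<dots> = (\<lambda>a. [(2::nat)] \<cdot> a) ` Tan0 M"
    using double by (intro image_cong) auto
  finally have target: "circle ` carrier M = (\<lambda>a. [(2::nat)] \<cdot> a) ` Tan0 M" .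
  obtain \<mu> where \<mu>: "\<mu> \<zero> = \<zero>" "\<And>a c. \<lbrakk>a \<in> Tan M; homogeneous a c\<rbrakk> \<Longrightarrow> \<mu> c = a\<degree>"
      "T_modulus_to M (restrict_semiring (semiring_of M) (circle ` carrier M) \<e>) \<mu>"
    using T_modulus_multiples[OF fk period characteristic_1_2(2)[OF assms]] double unit_T_closed
    unfolding target by auto
  have "\<mu> ([k] \<cdot> a) = a \<oplus> a \<and> a \<oplus> a = a\<degree>" if "a \<in> Tan M" "1 < k" for a and k :: nat
    using \<mu>(2) homogeneous_add_pow that first_kind_circ_tangible[OF fk] by simp
  then show ?thesis
    using \<mu> given_by_circ_of_rep_homogeneous[of \<mu>] by blast
qed

end


section \<open>The moduli of a metatangible mon-pair\<close>

theorem theorem3: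
  fixes M :: "('a, 'a, 'm) tbimod_scheme" and A0 :: "'a set" and d :: 'a
  assumes "metatangible_mon_pair M A0 d"
  shows
    "((\<forall>a1\<in>Tan0 M. \<forall>a2\<in>Tan0 M. \<forall>b1\<in>Tan0 M. \<forall>b2\<in>Tan0 M.
        circ M d a1 = circ M d b1 \<and> circ M d a2 = circ M d b2 \<longrightarrow>
        circ M d (a1 \<otimes>\<^bsub>Tan0_monoid M\<^esub> a2) = circ M d (b1 \<otimes>\<^bsub>Tan0_monoid M\<^esub> b2))
      \<and> monoid (Tan0_monoid M) \<and> monoid (Todot_monoid M d)
      \<and> circ M d \<in> hom (Tan0_monoid M) (Todot_monoid M d)
      \<and> circ M d \<one>\<^bsub>Tan0_monoid M\<^esub> = \<one>\<^bsub>Todot_monoid M d\<^esub>)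
    \<and>
    (A0_bipotent M A0 d \<longrightarrow>
      (semiring (Todot_semiring M d)
        \<and> idempotent_on (Todot_semiring M d) (carrier (Todot_semiring M d))
        \<and> (\<forall>a1\<in>Tan0 M. \<forall>a2\<in>Tan0 M. circ M d a1 \<noteq> circ M d a2 \<longrightarrow>
             dotplus M (circ M d a1) (circ M d a2) = circ M d (a1 \<oplus>\<^bsub>M\<^esub> a2)
             \<and> circ M d (a1 \<oplus>\<^bsub>M\<^esub> a2) = circ M d a1 \<oplus>\<^bsub>M\<^esub> circ M d a2)
        \<and> (\<forall>a1\<in>Tan0 M. \<forall>a2\<in>Tan0 M. circ M d a1 = circ M d a2 \<longrightarrow>
             dotplus M (circ M d a1) (circ M d a2) = circ M d a1))
      \<and>
      ((first_kind M A0 \<longrightarrow> unit_multiples_nonzero M) \<longrightarrow>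
        (\<exists>\<mu>. given_by_circ_of_rep M A0 d \<mu> \<and> T_modulus_to M (Todot_semiring M d) \<mu>))
      \<and>
      (second_kind M A0 \<longrightarrow>
        (\<forall>x\<in>circ M d ` Tan0 M. \<forall>y\<in>circ M d ` Tan0 M. dotplus M x y = x \<oplus>\<^bsub>M\<^esub> y)
        \<and> T_modulus_to M (restrict_semiring (semiring_of M) A0 (circ M d (unit_T M))) (circ M d)))
    \<and>
    (A0_bipotent M A0 d \<and> first_kind M A0 \<longrightarrow>
      (\<forall>m. has_period M m \<longrightarrow>
        sub_semiring (semiring_of M) ((\<lambda>a. [m] \<cdot>\<^bsub>M\<^esub> a) ` Tan0 M) ([m] \<cdot>\<^bsub>M\<^esub> unit_T M)
        \<and> bipotent_on (semiring_of M) ((\<lambda>a. [m] \<cdot>\<^bsub>M\<^esub> a) ` Tan0 M)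
        \<and> (unit_multiples_nonzero M \<longrightarrow>
            (\<exists>\<mu>. \<mu> \<zero>\<^bsub>M\<^esub> = \<zero>\<^bsub>M\<^esub>
              \<and> (\<forall>a\<in>Tan M. \<forall>k::nat. k \<ge> 1 \<longrightarrow> \<mu> ([k] \<cdot>\<^bsub>M\<^esub> a) = [m] \<cdot>\<^bsub>M\<^esub> a)
              \<and> T_modulus_to M (restrict_semiring (semiring_of M)
                  ((\<lambda>a. [m] \<cdot>\<^bsub>M\<^esub> a) ` Tan0 M) ([m] \<cdot>\<^bsub>M\<^esub> unit_T M)) \<mu>)))
      \<and>
      (has_characteristic M 1 2 \<longrightarrow>
        circ M d ` carrier M \<subseteq> A0
        \<and> (\<exists>\<mu>. given_by_circ_of_rep M A0 d \<mu>
            \<and> (\<forall>a\<in>Tan M. \<forall>k::nat. 1 < k \<longrightarrow>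
                 \<mu> ([k] \<cdot>\<^bsub>M\<^esub> a) = a \<oplus>\<^bsub>M\<^esub> a \<and> a \<oplus>\<^bsub>M\<^esub> a = circ M d a)
            \<and> T_modulus_to M (restrict_semiring (semiring_of M)
                (circ M d ` carrier M) (circ M d (unit_T M))) \<mu>)))"
proof -
  interpret metatangible_mon_pair M A0 d by fact
  have bip: "bipotent_mon_pair M A0 d" if "A0_bipotent M A0 d"
    using that metatangible_mon_pair_axioms
    by (auto simp: A0_bipotent_def bipotent_mon_pair_def bipotent_mon_pair_axioms_def)
  show ?thesis
  proof (rule conjI[OF _ conjI], goal_cases)
    case 1
    show ?case
    proof (intro conjI ballI impI)
      show "circ M d (a1 \<otimes>\<^bsub>Tan0_monoid M\<^esub> a2) = circ M d (b1 \<otimes>\<^bsub>Tan0_monoid M\<^esub> b2)"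
        if "a1 \<in> Tan0 M" "a2 \<in> Tan0 M" "b1 \<in> Tan0 M" "b2 \<in> Tan0 M"
          "circ M d a1 = circ M d b1 \<and> circ M d a2 = circ M d b2" for a1 a2 b1 b2
        using circ_mult_cong[OF that(1-4)] that(5) by blast
    qed (simp_all only: monoid_Tan0 monoid_Todot circ_hom Tan0_monoid_simps Todot_monoid_simps)
  next
    case 2
    show ?case
    proof (rule impI, rule conjI[OF _ conjI])
      assume "A0_bipotent M A0 d"
      then interpret bipotent_mon_pair M A0 d by (rule bip)
      show "semiring (Todot_semiring M d)
          \<and> idempotent_on (Todot_semiring M d) (carrier (Todot_semiring M d))
          \<and> (\<forall>a1\<in>Tan0 M. \<forall>a2\<in>Tan0 M. circ M d a1 \<noteq> circ M d a2 \<longrightarrow>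
               dotplus M (circ M d a1) (circ M d a2) = circ M d (a1 \<oplus>\<^bsub>M\<^esub> a2)
               \<and> circ M d (a1 \<oplus>\<^bsub>M\<^esub> a2) = circ M d a1 \<oplus>\<^bsub>M\<^esub> circ M d a2)
          \<and> (\<forall>a1\<in>Tan0 M. \<forall>a2\<in>Tan0 M. circ M d a1 = circ M d a2 \<longrightarrow>
               dotplus M (circ M d a1) (circ M d a2) = circ M d a1)"
        by (intro conjI ballI impI semiring_Todot idempotent_Todot dotplus_circ)
          (simp_all add: dotplus_def)
      show "(first_kind M A0 \<longrightarrow> unit_multiples_nonzero M) \<longrightarrow>
          (\<exists>\<mu>. given_by_circ_of_rep M A0 d \<mu> \<and> T_modulus_to M (Todot_semiring M d) \<mu>)"
        using T_modulus_Todot by blast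
      show "second_kind M A0 \<longrightarrow>
          (\<forall>x\<in>circ M d ` Tan0 M. \<forall>y\<in>circ M d ` Tan0 M. dotplus M x y = x \<oplus>\<^bsub>M\<^esub> y)
          \<and> T_modulus_to M (restrict_semiring (semiring_of M) A0 (circ M d (unit_T M))) (circ M d)"
        by (intro impI conjI ballI dotplus_second_kind T_modulus_circ_second_kind)
    qed
  next
    case 3
    show ?case
    proof (rule impI, rule conjI)
      assume A: "A0_bipotent M A0 d \<and> first_kind M A0"
      then interpret bipotent_mon_pair M A0 d using bip by blast
      have fk: "first_kind M A0" using A ..
      show "\<forall>m. has_period M m \<longrightarrow>
          sub_semiring (semiring_of M) ((\<lambda>a. [m] \<cdot>\<^bsub>M\<^esub> a) ` Tan0 M) ([m] \<cdot>\<^bsub>M\<^esub> unit_T M)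
          \<and> bipotent_on (semiring_of M) ((\<lambda>a. [m] \<cdot>\<^bsub>M\<^esub> a) ` Tan0 M)
          \<and> (unit_multiples_nonzero M \<longrightarrow>
              (\<exists>\<mu>. \<mu> \<zero>\<^bsub>M\<^esub> = \<zero>\<^bsub>M\<^esub>
                \<and> (\<forall>a\<in>Tan M. \<forall>k::nat. k \<ge> 1 \<longrightarrow> \<mu> ([k] \<cdot>\<^bsub>M\<^esub> a) = [m] \<cdot>\<^bsub>M\<^esub> a)
                \<and> T_modulus_to M (restrict_semiring (semiring_of M)
                    ((\<lambda>a. [m] \<cdot>\<^bsub>M\<^esub> a) ` Tan0 M) ([m] \<cdot>\<^bsub>M\<^esub> unit_T M)) \<mu>))"
      proof (intro allI impI conjI)
        fix m assume "has_period M m"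
        then have m: "m \<ge> 1" "[m] \<cdot>\<^bsub>M\<^esub> unit_T M \<oplus>\<^bsub>M\<^esub> [m] \<cdot>\<^bsub>M\<^esub> unit_T M = [m] \<cdot>\<^bsub>M\<^esub> unit_T M"
          by (auto simp: has_period_def)
        show "sub_semiring (semiring_of M) ((\<lambda>a. [m] \<cdot>\<^bsub>M\<^esub> a) ` Tan0 M) ([m] \<cdot>\<^bsub>M\<^esub> unit_T M)"
          by (rule sub_semiring_multiples[OF fk m])
        show "bipotent_on (semiring_of M) ((\<lambda>a. [m] \<cdot>\<^bsub>M\<^esub> a) ` Tan0 M)"
          by (rule bipotent_multiples[OF fk m])
        assume "unit_multiples_nonzero M"
        from T_modulus_multiples[OF fk m this] homogeneous_add_pow
        show "\<exists>\<mu>. \<mu> \<zero>\<^bsub>M\<^esub> = \<zero>\<^bsub>M\<^esub>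
            \<and> (\<forall>a\<in>Tan M. \<forall>k::nat. k \<ge> 1 \<longrightarrow> \<mu> ([k] \<cdot>\<^bsub>M\<^esub> a) = [m] \<cdot>\<^bsub>M\<^esub> a)
            \<and> T_modulus_to M (restrict_semiring (semiring_of M)
                ((\<lambda>a. [m] \<cdot>\<^bsub>M\<^esub> a) ` Tan0 M) ([m] \<cdot>\<^bsub>M\<^esub> unit_T M)) \<mu>"
          by blast
      qed
      show "has_characteristic M 1 2 \<longrightarrow> circ M d ` carrier M \<subseteq> A0
          \<and> (\<exists>\<mu>. given_by_circ_of_rep M A0 d \<mu>
              \<and> (\<forall>a\<in>Tan M. \<forall>k::nat. 1 < k \<longrightarrow>
                   \<mu> ([k] \<cdot>\<^bsub>M\<^esub> a) = a \<oplus>\<^bsub>M\<^esub> a \<and> a \<oplus>\<^bsub>M\<^esub> a = circ M d a)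
              \<and> T_modulus_to M (restrict_semiring (semiring_of M)
                  (circ M d ` carrier M) (circ M d (unit_T M))) \<mu>)"
        by (intro impI conjI image_subsetI circ_mem_A0 T_modulus_characteristic_1_2[OF fk])
    qed
  qed
qed

end
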